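(* Let $G$ be an unmixed bipartite graph on $2n$ vertices with no isolated vertices, with vertex set $\{x_1,\dots,x_n\}\cup\{y_1,\dots,y_n\}$ labelled as in the context, and let $\mathcal L_G$ be the associated sublattice of the Boolean lattice $\mathcal L_n$. Then $$\dim \overline{A(G)}=\operatorname{rank}\mathcal L_G+1,$$ where $\dim$ denotes Krull dimension.
   Context: Graphs are finite, without loops, multiple edges or isolated vertices. A vertex cover of $G$ is a subset $C\subseteq V(G)$ such that every edge of $G$ is incident to at least one vertex of $C$; it is minimal if no proper subset of $C$ is a vertex cover. $\mathcal M(G)$ denotes the set of minimal vertex covers of $G$. $G$ is unmixed if all elements of $\mathcal M(G)$ have the same cardinality. $G$ is bipartite if $V(G)$ is the disjoint union of two subsets $U,V$ such that every edge has exactly one endpoint in $U$ and one in $V$. Labelling convention: for an unmixed bipartite graph $G$ without isolated vertices, $U$ and $V$ have the same cardinality $n\ge 1$, and the vertices are labelled $U=\{x_1,\dots,x_n\}$, $V=\{y_1,\dots,y_n\}$ so that $\{x_i,y_i\}\in E(G)$ for all $i=1,\dots,n$ (this is always possible by the marriage theorem). With this labelling, every minimal vertex cover contains exactly one of $x_i,y_i$ for each $i$. The lattice: $\mathcal L_n$ is the Boolean lattice of all subsets of $\{x_1,\dots,x_n\}$, and $\mathcal L_G=\{C\cap\{x_1,\dots,x_n\} : C\in\mathcal M(G)\}$, which is a sublattice of $\mathcal L_n$ (closed under union and intersection). The rank of a sublattice $\mathcal L$ of $\mathcal L_n$ is the non-negative integer $l$ such that $l+1$ is the maximal cardinality of a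 chain in $\mathcal L$. The ring: let $K$ be a field, $S=K[x_1,\dots,x_n,y_1,\dots,y_n]$ with $\deg x_i=\deg y_i=1$, and $\mathfrak m$ the maximal graded ideal of $S$. For $C\in\mathcal M(G)$ let $u_C=\prod_{x_i\in C}x_i\prod_{y_j\in C}y_j\in S$. The vertex cover algebra of $G$ is the $S$-subalgebra $A(G)=S[u_Ct : C\in\mathcal M(G)]$ of $S[t]$, and $\overline{A(G)}:=A(G)/\mathfrak mA(G)\cong K[u_Ct : C\in\mathcal M(G)]\cong K[u_C : C\in\mathcal M(G)]$, i.e. the semigroup ring over $K$ generated by the monomials $u_C$, $C\in\mathcal M(G)$. *)

theory Defs
  imports
    "HOL-Library.Poly_Mapping"
    "HOL-Library.Extended_Nat"
    "HOL-Algebra.Generated_Rings"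
    "HOL-Computational_Algebra.Polynomial"
begin

section \<open>Graphs and vertex covers\<close>

definition simple_graph :: "'v set \<Rightarrow> 'v set set \<Rightarrow> bool" where
  "simple_graph V E \<longleftrightarrow> finite V \<and> (\<forall>e\<in>E. e \<subseteq> V \<and> card e = 2)"

definition no_isolated_vertices :: "'v set \<Rightarrow> 'v set set \<Rightarrow> bool" where
  "no_isolated_vertices V E \<longleftrightarrow> (\<forall>v\<in>V. \<exists>e\<in>E. v \<in> e)"

definition bipartition :: "'v set \<Rightarrow> 'v set set \<Rightarrow> 'v set \<Rightarrow> 'v set \<Rightarrow> bool" where
  "bipartition V E U W \<longleftrightarrow> V = U \<union> W \<and> U \<inter> W = {} \<and>
     (\<forall>e\<in>E. card (e \<inter> U) = 1 \<and> card (e \<inter> W) = 1)"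

definition vertex_cover :: "'v set \<Rightarrow> 'v set set \<Rightarrow> 'v set \<Rightarrow> bool" where
  "vertex_cover V E C \<longleftrightarrow> C \<subseteq> V \<and> (\<forall>e\<in>E. e \<inter> C \<noteq> {})"

definition minimal_vertex_covers :: "'v set \<Rightarrow> 'v set set \<Rightarrow> 'v set set" where
  "minimal_vertex_covers V E =
     {C. vertex_cover V E C \<and> (\<forall>D. D \<subset> C \<longrightarrow> \<not> vertex_cover V E D)}"

definition unmixed :: "'v set \<Rightarrow> 'v set set \<Rightarrow> bool" where
  "unmixed V E \<longleftrightarrow>
     (\<forall>C\<in>minimal_vertex_covers V E. \<forall>D\<in>minimal_vertex_covers V E. card C = card D)"


section \<open>The lattice of a graph\<close>

definition cover_lattice :: "'v set \<Rightarrow> 'v set set \<Rightarrow> 'v set \<Rightarrow> 'v set set" where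
  "cover_lattice V E U = {C \<inter> U | C. C \<in> minimal_vertex_covers V E}"

text \<open>Intended for finite nonempty families, where the maximum exists and is at least 1.\<close>

definition lattice_rank :: "'v set set \<Rightarrow> nat" where
  "lattice_rank L = Max {card C | C. subset.chain L C} - 1"


section \<open>Krull dimension\<close>

text \<open>The supremum of the lengths of strict chains of prime ideals.
  The zero ring, which has no prime ideals, gets dimension 0 here.\<close>

definition krull_dim :: "('a, 'b) ring_scheme \<Rightarrow> enat" where
  "krull_dim R = Sup {enat l | l. \<exists>P :: nat \<Rightarrow> 'a set.
     (\<forall>i\<le>l. primeideal (P i) R) \<and> (\<forall>i<l. P i \<subset> P (Suc i))}"


section \<open>The vertex cover algebra\<close>

type_synonym ('v, 'k) mpoly = "('v \<Rightarrow>\<^sub>0 nat) \<Rightarrow>\<^sub>0 'k"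

definition mvar :: "'v \<Rightarrow> ('v, 'k::field) mpoly" where
  "mvar v = Poly_Mapping.single (Poly_Mapping.single v 1) 1"

text \<open>\<open>S = K[v | v \<in> V]\<close>, inside the polynomials in all variables from the type \<open>'v\<close>.\<close>

definition mpoly_ring :: "'v set \<Rightarrow> ('v, 'k::field) mpoly ring" where
  "mpoly_ring V =
     \<lparr>carrier = {p. \<forall>m\<in>Poly_Mapping.keys p. Poly_Mapping.keys m \<subseteq> V},
      monoid.mult = (*), one = 1, zero = 0, add = (+)\<rparr>"

text \<open>\<open>S[t]\<close>, as univariate polynomials all of whose coefficients lie in \<open>S\<close>.\<close>

definition mpoly_ring_t :: "'v set \<Rightarrow> ('v, 'k::field) mpoly poly ring" where
  "mpoly_ring_t V =
     \<lparr>carrier = {f. \<forall>i. Polynomial.coeff f i \<in> carrier (mpoly_ring V)},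
      monoid.mult = (*), one = 1, zero = 0, add = (+)\<rparr>"

definition graded_maximal_ideal :: "'v set \<Rightarrow> ('v, 'k::field) mpoly set" where
  "graded_maximal_ideal V = Idl\<^bsub>mpoly_ring V\<^esub> (mvar ` V)"

definition cover_monomial :: "'v set \<Rightarrow> ('v, 'k::field) mpoly" where
  "cover_monomial C = (\<Prod>v\<in>C. mvar v)"

text \<open>\<open>A(G) = S[u\<^sub>C t | C \<in> M(G)]\<close>, generated as a ring by the constants from \<open>S\<close> and the
  \<open>u\<^sub>C t\<close>.\<close>

definition vertex_cover_algebra ::
    "'v set \<Rightarrow> 'v set set \<Rightarrow> ('v, 'k::field) mpoly poly ring" where
  "vertex_cover_algebra V E = (mpoly_ring_t V)
     \<lparr>carrier := generate_ring (mpoly_ring_t V)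
       ((\<lambda>s. [:s:]) ` carrier (mpoly_ring V) \<union>
        (\<lambda>C. Polynomial.monom (cover_monomial C) 1) ` minimal_vertex_covers V E)\<rparr>"

text \<open>\<open>A(G) / \<mm> A(G)\<close>\<close>

definition vertex_cover_fibre ::
    "'v set \<Rightarrow> 'v set set \<Rightarrow> ('v, 'k::field) mpoly poly set ring" where
  "vertex_cover_fibre V E = vertex_cover_algebra V E Quot
     (Idl\<^bsub>vertex_cover_algebra V E\<^esub> ((\<lambda>s. [:s:]) ` graded_maximal_ideal V))"

end

theory Submission
  imports Defs
begin

text \<open>
  The fibre \<open>A(G) / \<mm> A(G)\<close> is a ring of monomials, and its Krull dimension is read off from the
  embedding into a polynomial ring that has exactly as many variables as the dimension should be.

  Since \<open>G\<close> is unmixed, all \<open>u\<^sub>C\<close> have the same degree \<open>n\<close>. A monomial \<open>m t\<^sup>k\<close> of \<open>A(G)\<close> is a product of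
  \<open>k\<close> of the \<open>u\<^sub>C t\<close> and of a monomial of \<open>S\<close>, so its degree in the variables of \<open>S\<close> is at least \<open>k n\<close>,
  and it lies outside \<open>\<mm> A(G)\<close> exactly when equality holds. Keeping only these monomials is therefore
  a ring homomorphism on \<open>A(G)\<close> with kernel \<open>\<mm> A(G)\<close>, and so is the same operation followed by
  any injective additive renaming of the exponents that occur (\<open>fibre_as_monomial_algebra\<close>).

  A renaming into few variables comes from a chain \<open>c\<^sub>0 \<subset> \<dots> \<subset> c\<^sub>r\<close> of maximal size in the lattice \<open>L\<close> of the
  graph, where \<open>r\<close> is the rank. It runs from the empty set to \<open>{x\<^sub>1,\<dots>,x\<^sub>n}\<close>. If \<open>v\<close> and \<open>w\<close> both enter at the
  step from \<open>c\<^sub>i\<close> to \<open>c\<^sub>i\<^sub>+\<^sub>1\<close>, then every \<open>A\<close> in \<open>L\<close> contains both or neither of them, because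
  \<open>(A \<union> c\<^sub>i) \<inter> c\<^sub>i\<^sub>+\<^sub>1\<close> belongs to \<open>L\<close> and would otherwise refine the chain
  (\<open>sublattice_constant_on_chain_steps\<close>). As each cover contains exactly one of \<open>x\<^sub>i, y\<^sub>i\<close>, a product of
  \<open>k\<close> of the \<open>u\<^sub>C\<close> is determined by \<open>k\<close> and by the exponents of one variable per step. So the fibre
  is isomorphic to a subalgebra \<open>B\<close> of \<open>K[z\<^sub>0,\<dots>,z\<^sub>r]\<close>, where \<open>z\<^sub>0\<close> records \<open>k\<close>; the cover that belongs to \<open>c\<^sub>s\<close> goes
  to \<open>z\<^sub>0 z\<^sub>1 \<cdots> z\<^sub>s\<close>.

  Such a subalgebra has dimension \<open>r + 1\<close> (\<open>krull_dim_subalgebra\<close>). For the lower bound, the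
  polynomials of \<open>B\<close> without a monomial in \<open>z\<^sub>0,\<dots>,z\<^sub>s\<^sub>-\<^sub>1\<close> alone form a prime ideal, and the elements
  \<open>z\<^sub>0 \<cdots> z\<^sub>s\<close> separate consecutive ones. For the upper bound, elements \<open>x\<^sub>i\<close> of \<open>P\<^sub>i\<^sub>+\<^sub>1 - P\<^sub>i\<close>, taken along a
  chain of prime ideals, are algebraically independent over \<open>K\<close> (\<open>prime_chain_independent\<close>): in a
  polynomial relation one can cancel the least power of \<open>x\<^sub>0\<close> modulo \<open>P\<^sub>0\<close>, pass to \<open>P\<^sub>1\<close>, and
  continue until a nonzero constant is left. But \<open>r + 2\<close> polynomials in \<open>r + 1\<close> variables are dependent,
  because they have more power products of bounded exponents than there are monomials to expand them in
  (\<open>algebraically_dependent\<close>).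
\<close>

section \<open>Polynomial rings as carriers\<close>

lemma mpoly_ring_simps [simp]:
  "x \<otimes>\<^bsub>mpoly_ring V\<^esub> y = x * y" "x \<oplus>\<^bsub>mpoly_ring V\<^esub> y = x + y"
  "\<one>\<^bsub>mpoly_ring V\<^esub> = 1" "\<zero>\<^bsub>mpoly_ring V\<^esub> = 0"
  by (simp_all add: mpoly_ring_def)

lemma keys_times_subset:
  assumes "m \<in> Poly_Mapping.keys (p * q)"
  obtains a b where "a \<in> Poly_Mapping.keys p" "b \<in> Poly_Mapping.keys q" "m = a + b"
  using keys_mult[of p q] assms by blast

lemma keys_plus_nat: "Poly_Mapping.keys (a + b :: 'v \<Rightarrow>\<^sub>0 nat) = Poly_Mapping.keys a \<union> Poly_Mapping.keys b"
  by (auto simp: in_keys_iff lookup_add)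

lemma mpoly_ring_carrier: "p \<in> carrier (mpoly_ring V) \<longleftrightarrow> (\<forall>m\<in>Poly_Mapping.keys p. Poly_Mapping.keys m \<subseteq> V)"
  by (simp add: mpoly_ring_def)

lemma mpoly_ring_mult_closed:
  assumes "p \<in> carrier (mpoly_ring V)" "q \<in> carrier (mpoly_ring V)"
  shows "p * q \<in> carrier (mpoly_ring V)"
  unfolding mpoly_ring_carrier
proof
  fix m assume "m \<in> Poly_Mapping.keys (p * q)"
  then obtain a b where "a \<in> Poly_Mapping.keys p" "b \<in> Poly_Mapping.keys q" "m = a + b"
    by (rule keys_times_subset)
  then show "Poly_Mapping.keys m \<subseteq> V"
    using assms by (simp add: mpoly_ring_carrier keys_plus_nat)
qed

lemma cring_mpoly_ring: "cring (mpoly_ring V :: ('v, 'k::field) mpoly ring)"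
proof (rule cringI)
  show "abelian_group (mpoly_ring V :: ('v, 'k) mpoly ring)"
  proof (rule abelian_groupI)
    fix x :: "('v, 'k) mpoly"
    assume "x \<in> carrier (mpoly_ring V)"
    then show "\<exists>y\<in>carrier (mpoly_ring V). y \<oplus>\<^bsub>mpoly_ring V\<^esub> x = \<zero>\<^bsub>mpoly_ring V\<^esub>"
      by (intro bexI[of _ "- x"]) (simp_all add: mpoly_ring_carrier)
  qed (use keys_add in \<open>fastforce simp: mpoly_ring_carrier algebra_simps\<close>)+
next
  show "comm_monoid (mpoly_ring V :: ('v, 'k) mpoly ring)"
    by (rule comm_monoidI)
      (simp_all add: mpoly_ring_mult_closed mult_ac, simp add: mpoly_ring_carrier)
qed (simp_all add: algebra_simps)

lemma sum_monomials: "(\<Sum>m\<in>Poly_Mapping.keys p. Poly_Mapping.single m (Poly_Mapping.lookup p m)) = p"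
proof (rule poly_mapping_eqI)
  fix k
  have "Poly_Mapping.lookup (\<Sum>m\<in>Poly_Mapping.keys p. Poly_Mapping.single m (Poly_Mapping.lookup p m)) k =
      (\<Sum>m\<in>Poly_Mapping.keys p. if m = k then Poly_Mapping.lookup p m else 0)"
    by (simp add: lookup_sum lookup_single when_def)
  also have "\<dots> = Poly_Mapping.lookup p k" by (simp add: in_keys_iff)
  finally show "Poly_Mapping.lookup (\<Sum>m\<in>Poly_Mapping.keys p. Poly_Mapping.single m (Poly_Mapping.lookup p m)) k =
      Poly_Mapping.lookup p k" .
qed

lemma mpoly_ring_t_simps [simp]:
  "f \<otimes>\<^bsub>mpoly_ring_t V\<^esub> g = f * g" "f \<oplus>\<^bsub>mpoly_ring_t V\<^esub> g = f + g"
  "\<one>\<^bsub>mpoly_ring_t V\<^esub> = 1" "\<zero>\<^bsub>mpoly_ring_t V\<^esub> = 0"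
  by (simp_all add: mpoly_ring_t_def)

lemma mpoly_ring_t_carrier:
  "f \<in> carrier (mpoly_ring_t V) \<longleftrightarrow> (\<forall>i. poly.coeff f i \<in> carrier (mpoly_ring V))"
  by (simp add: mpoly_ring_t_def)

lemma mpoly_ring_add_closed:
  "p \<in> carrier (mpoly_ring V) \<Longrightarrow> q \<in> carrier (mpoly_ring V) \<Longrightarrow> p + q \<in> carrier (mpoly_ring V)"
  using keys_add[of p q] by (auto simp: mpoly_ring_carrier)

lemma mpoly_ring_sum_closed:
  "(\<And>i. i \<in> I \<Longrightarrow> p i \<in> carrier (mpoly_ring V)) \<Longrightarrow> (\<Sum>i\<in>I. p i) \<in> carrier (mpoly_ring V)"
  by (induction I rule: infinite_finite_induct)
    (simp_all add: mpoly_ring_add_closed, simp_all add: mpoly_ring_carrier)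

lemma mpoly_ring_t_mult_closed:
  "f \<in> carrier (mpoly_ring_t V) \<Longrightarrow> g \<in> carrier (mpoly_ring_t V) \<Longrightarrow> f * g \<in> carrier (mpoly_ring_t V)"
  unfolding mpoly_ring_t_carrier coeff_mult
  by (intro allI mpoly_ring_sum_closed mpoly_ring_mult_closed) simp_all

lemma cring_mpoly_ring_t: "cring (mpoly_ring_t V :: ('v, 'k::field) mpoly poly ring)"
proof (rule cringI)
  show "abelian_group (mpoly_ring_t V :: ('v, 'k) mpoly poly ring)"
  proof (rule abelian_groupI)
    fix f :: "('v, 'k) mpoly poly"
    assume "f \<in> carrier (mpoly_ring_t V)"
    then show "\<exists>g\<in>carrier (mpoly_ring_t V). g \<oplus>\<^bsub>mpoly_ring_t V\<^esub> f = \<zero>\<^bsub>mpoly_ring_t V\<^esub>"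
      by (intro bexI[of _ "- f"]) (simp_all add: mpoly_ring_t_carrier mpoly_ring_carrier)
  qed (simp_all add: mpoly_ring_t_carrier mpoly_ring_add_closed algebra_simps, simp add: mpoly_ring_carrier)
next
  show "comm_monoid (mpoly_ring_t V :: ('v, 'k) mpoly poly ring)"
    by (rule comm_monoidI)
      (simp_all add: mpoly_ring_t_mult_closed mult_ac, simp add: mpoly_ring_t_carrier mpoly_ring_carrier coeff_1)
qed (simp_all add: algebra_simps)

lemma mpoly_ring_t_minus: "f \<in> carrier (mpoly_ring_t V) \<Longrightarrow> \<ominus>\<^bsub>mpoly_ring_t V\<^esub> f = - f"
proof -
  assume f: "f \<in> carrier (mpoly_ring_t V)"
  interpret cring "mpoly_ring_t V" by (rule cring_mpoly_ring_t)
  show ?thesis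
    by (rule minus_equality) (use f in \<open>auto simp: mpoly_ring_t_carrier mpoly_ring_carrier\<close>)
qed

section \<open>Chains of prime ideals and algebraic independence\<close>

definition exponent_lists :: "nat \<Rightarrow> nat \<Rightarrow> nat list set" where
  "exponent_lists N l = {es. set es \<subseteq> {..N} \<and> length es = l}"

text \<open>
  Power products are indexed by lists of exponents, so that a polynomial relation between
  \<open>x # xs\<close> is visibly a polynomial in \<open>x\<close> whose coefficients are polynomials in \<open>xs\<close>. Lists of
  different lengths do not occur; the second equation is the empty product.
\<close>

fun powprod :: "'a::comm_monoid_mult list \<Rightarrow> nat list \<Rightarrow> 'a" where
  "powprod (x # xs) (e # es) = x ^ e * powprod xs es"
| "powprod _ _ = 1"

lemma finite_exponent_lists: "finite (exponent_lists N l)"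
  unfolding exponent_lists_def by (rule finite_lists_length_eq) simp

lemma card_exponent_lists: "card (exponent_lists N l) = (N + 1) ^ l"
  unfolding exponent_lists_def by (subst card_lists_length_eq) simp_all

lemma exponent_lists_0: "exponent_lists N 0 = {[]}"
  by (auto simp: exponent_lists_def)

lemma exponent_lists_Suc:
  "exponent_lists N (Suc l) = (\<lambda>(e, es). e # es) ` ({..N} \<times> exponent_lists N l)"
  by (auto simp: exponent_lists_def length_Suc_conv image_iff)

lemma sum_exponent_lists_Suc:
  "(\<Sum>es\<in>exponent_lists N (Suc l). f es) = (\<Sum>e\<le>N. \<Sum>es\<in>exponent_lists N l. f (e # es))"
proof -
  have "inj_on (\<lambda>(e, es). e # es) ({..N} \<times> exponent_lists N l)"
    by (auto simp: inj_on_def)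
  then show ?thesis
    by (simp add: exponent_lists_Suc sum.reindex sum.cartesian_product split_def o_def)
qed

text \<open>
  The relation is only required to hold modulo \<open>P 0\<close>, which is what makes the induction on \<open>xs\<close> work.
  Sort the relation by powers of the first element, \<open>\<Sum>\<^sub>e x\<^sup>e g\<^sub>e \<in> P\<^sub>0\<close>. If \<open>g\<^sub>0,\<dots>,g\<^sub>e\<^sub>-\<^sub>1\<close> vanish, then
  \<open>x\<^sup>e\<close> can be cancelled modulo \<open>P\<^sub>0\<close>, since \<open>x\<close> is not in this prime ideal. This leaves \<open>g\<^sub>e + x h\<close> in
  \<open>P\<^sub>0 \<subseteq> P\<^sub>1\<close>, and as \<open>x \<in> P\<^sub>1\<close>, also \<open>g\<^sub>e \<in> P\<^sub>1\<close>, which is a relation modulo \<open>P\<^sub>1\<close> between the remaining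
  elements. At the end of the chain a constant lies in a prime ideal, so it is zero.
\<close>

lemma prime_chain_independent:
  fixes B :: "('v, 'k::field) mpoly set" and V :: "'v set"
  defines "R \<equiv> (mpoly_ring V)\<lparr>carrier := B\<rparr>"
  assumes const: "\<And>c. Poly_Mapping.single 0 c \<in> B"
    and primes: "\<And>i. i \<le> length xs \<Longrightarrow> primeideal (P i) R"
    and incl: "\<And>i. i < length xs \<Longrightarrow> P i \<subseteq> P (Suc i)"
    and step: "\<And>i. i < length xs \<Longrightarrow> xs ! i \<in> P (Suc i) - P i"
    and sum: "(\<Sum>es\<in>exponent_lists N (length xs). Poly_Mapping.single 0 (c es) * powprod xs es) \<in> P 0"
    and "es \<in> exponent_lists N (length xs)"
  shows "c es = 0"
  using primes incl step sum \<open>es \<in> exponent_lists N (length xs)\<close>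
proof (induction xs arbitrary: P c es)
  case Nil
  interpret primeideal "P 0" R using Nil(1) by simp
  show ?case
  proof (rule ccontr)
    assume "c es \<noteq> 0"
    then have "c [] \<noteq> 0" using Nil by (simp add: exponent_lists_0)
    have "Poly_Mapping.single 0 (c []) \<in> P 0"
      using Nil.prems(4) by (simp add: exponent_lists_0)
    then have "Poly_Mapping.single 0 (inverse (c [])) \<otimes>\<^bsub>R\<^esub> Poly_Mapping.single 0 (c []) \<in> P 0"
      by (rule I_l_closed) (simp add: R_def const)
    then have "\<one>\<^bsub>R\<^esub> \<in> P 0"
      using \<open>c [] \<noteq> 0\<close> by (simp add: R_def mult_single)
    then show False
      using I_notcarr one_imp_carrier by blast
  qed
next
  case (Cons x xs)
  interpret p0: primeideal "P 0" R using Cons.prems(1) by simp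
  interpret p1: primeideal "P (Suc 0)" R using Cons.prems(1) by simp
  have carr [simp]: "carrier R = B" by (simp add: R_def)
  have add: "a + b \<in> B" if "a \<in> B" "b \<in> B" for a b
    using p0.add.m_closed[of a b] that by (simp add: R_def)
  have mult: "a * b \<in> B" if "a \<in> B" "b \<in> B" for a b
    using p0.m_closed[of a b] that by (simp add: R_def)
  have B0: "0 \<in> B" and B1: "1 \<in> B" using const[of 0] const[of 1] by simp_all
  have sumB: "(\<Sum>i\<in>I. f i) \<in> B" if "\<And>i. i \<in> I \<Longrightarrow> f i \<in> B" for I :: "'i set" and f
    using that by (induction I rule: infinite_finite_induct) (auto intro: add B0)
  have powB: "a ^ k \<in> B" if "a \<in> B" for a and k :: nat
    using that by (induction k) (auto intro: mult B1)
  have xsB: "set (x # xs) \<subseteq> B"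
  proof
    fix z assume "z \<in> set (x # xs)"
    then obtain i where i: "i < length (x # xs)" "z = (x # xs) ! i" by (metis in_set_conv_nth)
    interpret pi: primeideal "P (Suc i)" R using Cons.prems(1) i by simp
    show "z \<in> B" using Cons.prems(3)[OF i(1)] i(2) pi.Icarr by simp
  qed
  have ppB: "powprod ys es \<in> B" if "set ys \<subseteq> B" for ys and es :: "nat list"
    using that by (induction ys es rule: powprod.induct) (auto intro: mult powB B1)
  have x: "x \<in> P (Suc 0)" "x \<notin> P 0" "x \<in> B" using Cons.prems(3)[of 0] xsB by auto
  have xpow: "x ^ k \<notin> P 0" for k :: nat
  proof (induction k)
    case 0
    then show ?case using p0.I_notcarr p0.one_imp_carrier by (auto simp: R_def)
  next
    case (Suc k)
    then show ?case using p0.I_prime[of x "x ^ k"] x powB by (auto simp: R_def)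
  qed
  define g where "g e = (\<Sum>es\<in>exponent_lists N (length xs). Poly_Mapping.single 0 (c (e # es)) * powprod xs es)" for e
  have gB: "g e \<in> B" for e
    unfolding g_def using xsB by (intro sumB mult const ppB) auto
  have total: "(\<Sum>e\<le>N. x ^ e * g e) \<in> P 0"
    using Cons.prems(4) by (simp add: sum_exponent_lists_Suc g_def sum_distrib_left mult_ac)
  have zero: "\<forall>es\<in>exponent_lists N (length xs). c (e # es) = 0" if "e \<le> N" for e
    using that
  proof (induction e rule: less_induct)
    case (less e)
    have g0: "g e' = 0" if "e' < e" for e'
      using less that by (simp add: g_def)
    \<comment> \<open>the sum is \<open>x\<^sup>e (g e + x h)\<close>, as the terms below \<open>e\<close> are known to vanish\<close>
    define h where "h = (\<Sum>e'\<in>{Suc e..N}. x ^ (e' - Suc e) * g e')"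
    have hB: "h \<in> B" unfolding h_def by (intro sumB mult powB gB x)
    have "(\<Sum>e'\<le>N. x ^ e' * g e') = (\<Sum>e'\<in>{e..N}. x ^ e' * g e')"
      by (rule sum.mono_neutral_right) (auto simp: g0)
    also have "\<dots> = x ^ e * g e + (\<Sum>e'\<in>{Suc e..N}. x ^ e' * g e')"
      using less.prems by (rule sum.atLeast_Suc_atMost)
    also have "(\<Sum>e'\<in>{Suc e..N}. x ^ e' * g e') = (\<Sum>e'\<in>{Suc e..N}. x ^ e * (x * (x ^ (e' - Suc e) * g e')))"
    proof (rule sum.cong[OF refl])
      fix e' assume "e' \<in> {Suc e..N}"
      then have "e' = e + 1 + (e' - Suc e)" by simp
      then have "x ^ e' = x ^ e * x * x ^ (e' - Suc e)" by (metis power_add power_one_right)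
      then show "x ^ e' * g e' = x ^ e * (x * (x ^ (e' - Suc e) * g e'))" by (simp add: mult_ac)
    qed
    also have "x ^ e * g e + \<dots> = x ^ e * (g e + x * h)"
      by (simp add: h_def sum_distrib_left algebra_simps)
    finally have "x ^ e \<otimes>\<^bsub>R\<^esub> (g e + x * h) \<in> P 0" using total by (simp add: R_def)
    then have "g e + x * h \<in> P 0"
      using p0.I_prime[of "x ^ e" "g e + x * h"] xpow by (simp add: powB x add mult gB hB)
    then have 1: "g e + x * h \<in> P (Suc 0)" using Cons.prems(2)[of 0] by auto
    have "(- h) \<in> B" using mult[OF const[of "-1"] hB] by (simp add: single_uminus)
    then have "x \<otimes>\<^bsub>R\<^esub> (- h) \<in> P (Suc 0)" using x(1) by (intro p1.I_r_closed) auto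
    then have "(g e + x * h) \<oplus>\<^bsub>R\<^esub> (x * (- h)) \<in> P (Suc 0)"
      using 1 by (intro p1.a_closed) (simp_all add: R_def)
    then have 2: "g e \<in> P (Suc 0)" by (simp add: R_def)
    show ?case
    proof
      fix es assume es: "es \<in> exponent_lists N (length xs)"
      show "c (e # es) = 0"
      proof (rule Cons.IH[of "\<lambda>i. P (Suc i)" "\<lambda>es. c (e # es)" es])
        fix i
        show "primeideal (P (Suc i)) R" if "i \<le> length xs" using Cons.prems(1) that by simp
        show "P (Suc i) \<subseteq> P (Suc (Suc i))" if "i < length xs" using Cons.prems(2) that by simp
        show "xs ! i \<in> P (Suc (Suc i)) - P (Suc i)" if "i < length xs"
          using Cons.prems(3)[of "Suc i"] that by simp
      qed (use 2 es in \<open>simp_all add: g_def\<close>)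
    qed
  qed
  show ?case using Cons.prems(5) zero by (auto simp: exponent_lists_Suc)
qed

section \<open>Algebraic dependence by counting monomials\<close>

definition bounded_monomials :: "'v set \<Rightarrow> nat \<Rightarrow> ('v \<Rightarrow>\<^sub>0 nat) set" where
  "bounded_monomials V M = {w. Poly_Mapping.keys w \<subseteq> V \<and> (\<forall>v. Poly_Mapping.lookup w v \<le> M)}"

lemma bounded_monomials:
  assumes "finite V"
  shows finite_bounded_monomials: "finite (bounded_monomials V M)"
    and card_bounded_monomials: "card (bounded_monomials V M) \<le> (M + 1) ^ card V"
proof -
  let ?f = "\<lambda>w. restrict (Poly_Mapping.lookup w) V"
  have inj: "inj_on ?f (bounded_monomials V M)"
  proof (rule inj_onI)
    fix a b assume ab: "a \<in> bounded_monomials V M" "b \<in> bounded_monomials V M" "?f a = ?f b"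
    show "a = b"
    proof (rule poly_mapping_eqI)
      fix v
      show "Poly_Mapping.lookup a v = Poly_Mapping.lookup b v"
      proof (cases "v \<in> V")
        case True
        then show ?thesis using fun_cong[OF ab(3), of v] by simp
      next
        case False
        then have "v \<notin> Poly_Mapping.keys a" "v \<notin> Poly_Mapping.keys b"
          using ab by (auto simp: bounded_monomials_def)
        then show ?thesis by (simp add: in_keys_iff)
      qed
    qed
  qed
  have sub: "?f ` bounded_monomials V M \<subseteq> V \<rightarrow>\<^sub>E {..M}"
    by (auto simp: bounded_monomials_def)
  have fin: "finite (V \<rightarrow>\<^sub>E {..M})" using assms by (simp add: finite_PiE)
  show "finite (bounded_monomials V M)"
    using finite_imageD[OF finite_subset[OF sub fin] inj] .
  show "card (bounded_monomials V M) \<le> (M + 1) ^ card V"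
    using card_inj_on_le[OF inj sub fin] assms by (simp add: card_PiE)
qed

lemma bounded_monomials_mono: "M \<le> M' \<Longrightarrow> bounded_monomials V M \<subseteq> bounded_monomials V M'"
  unfolding bounded_monomials_def using order_trans by blast

lemma keys_times_bounded:
  assumes "Poly_Mapping.keys p \<subseteq> bounded_monomials V M" "Poly_Mapping.keys q \<subseteq> bounded_monomials V M'"
  shows "Poly_Mapping.keys (p * q) \<subseteq> bounded_monomials V (M + M')"
proof
  fix m assume "m \<in> Poly_Mapping.keys (p * q)"
  then obtain a b where "a \<in> Poly_Mapping.keys p" "b \<in> Poly_Mapping.keys q" "m = a + b"
    by (rule keys_times_subset)
  then have "a \<in> bounded_monomials V M" "b \<in> bounded_monomials V M'" using assms by auto
  then show "m \<in> bounded_monomials V (M + M')"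
    unfolding \<open>m = a + b\<close> by (auto simp: bounded_monomials_def keys_plus_nat lookup_add add_mono)
qed

lemma keys_power_bounded:
  assumes "Poly_Mapping.keys p \<subseteq> bounded_monomials V M"
  shows "Poly_Mapping.keys (p ^ e) \<subseteq> bounded_monomials V (M * e)"
proof (induction e)
  case 0
  then show ?case by (simp add: bounded_monomials_def)
next
  case (Suc e)
  show ?case using keys_times_bounded[OF assms Suc] by (simp add: algebra_simps)
qed

text \<open>
  With the polynomials fixed, the exponents in their power products grow only linearly in \<open>N\<close>.
\<close>

lemma keys_powprod_bounded:
  assumes "\<And>x. x \<in> set xs \<Longrightarrow> Poly_Mapping.keys x \<subseteq> bounded_monomials V M"
    and "es \<in> exponent_lists N (length xs)"
  shows "Poly_Mapping.keys (powprod xs es) \<subseteq> bounded_monomials V (M * N * length xs)"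
  using assms
proof (induction xs arbitrary: es)
  case Nil
  then show ?case by (auto simp: exponent_lists_0 bounded_monomials_def)
next
  case (Cons x xs)
  obtain e es' where es: "es = e # es'" "e \<le> N" "es' \<in> exponent_lists N (length xs)"
    using Cons.prems(2) by (auto simp: exponent_lists_Suc)
  have "M * e \<le> M * N" using es(2) by simp
  then have "Poly_Mapping.keys (x ^ e) \<subseteq> bounded_monomials V (M * N)"
    using keys_power_bounded[OF Cons.prems(1), of x e] bounded_monomials_mono[of "M * e" "M * N" V]
    by (meson list.set_intros(1) order_trans)
  moreover have "Poly_Mapping.keys (powprod xs es') \<subseteq> bounded_monomials V (M * N * length xs)"
    using Cons.IH[OF Cons.prems(1) es(3)] by simp
  ultimately show ?case
    using keys_times_bounded[of "x ^ e" V "M * N" "powprod xs es'" "M * N * length xs"]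
    by (simp add: es(1) algebra_simps)
qed

text \<open>
  Let \<open>d = card V\<close>. There are \<open>(N + 1)\<^sup>d\<^sup>+\<^sup>1\<close> power products with exponents up to \<open>N\<close>, and they
  lie in the span of \<open>O(N\<^sup>d)\<close> monomials. So they are linearly dependent for large \<open>N\<close>.
\<close>

lemma algebraically_dependent:
  fixes xs :: "('v, 'k::field) mpoly list"
  assumes "finite V" and "length xs = Suc (card V)" and "set xs \<subseteq> carrier (mpoly_ring V)"
  obtains N c es where "es \<in> exponent_lists N (length xs)" "c es \<noteq> 0"
    "(\<Sum>es\<in>exponent_lists N (length xs). Poly_Mapping.single 0 (c es) * powprod xs es) = 0"
proof -
  define d where "d = card V"
  have "\<exists>M. \<forall>x\<in>set xs. Poly_Mapping.keys x \<subseteq> bounded_monomials V M"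
  proof -
    define E where "E = (\<Union>x\<in>set xs. \<Union>w\<in>Poly_Mapping.keys x. Poly_Mapping.lookup w ` V)"
    have fin: "finite E" unfolding E_def using assms(1) by auto
    have "Poly_Mapping.keys x \<subseteq> bounded_monomials V (Max (insert 0 E))" if "x \<in> set xs" for x
    proof
      fix w assume w: "w \<in> Poly_Mapping.keys x"
      have sub: "Poly_Mapping.keys w \<subseteq> V" using assms(3) that w mpoly_ring_carrier[of x V] by blast
      have "Poly_Mapping.lookup w v \<le> Max (insert 0 E)" for v
      proof (cases "v \<in> V")
        case True
        then have "Poly_Mapping.lookup w v \<in> E" using that w by (auto simp: E_def)
        then show ?thesis using fin by simp
      next
        case False
        then show ?thesis using sub by (metis in_keys_iff subsetD zero_le)
      qed
      then show "w \<in> bounded_monomials V (Max (insert 0 E))" using sub by (simp add: bounded_monomials_def)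
    qed
    then show ?thesis by blast
  qed
  then obtain M where M: "\<And>x. x \<in> set xs \<Longrightarrow> Poly_Mapping.keys x \<subseteq> bounded_monomials V M" by blast
  \<comment> \<open>at most \<open>(A (N + 1))\<^sup>d\<close> monomials occur, which is less than \<open>(N + 1)\<^sup>d\<^sup>+\<^sup>1\<close> once \<open>N \<ge> A\<^sup>d\<close>\<close>
  define A where "A = M * Suc d + 1"
  define N where "N = A ^ d"
  define W where "W = bounded_monomials V (M * N * length xs)"
  let ?X = "exponent_lists N (length xs)"
  have finW: "finite W" unfolding W_def using assms(1) by (rule finite_bounded_monomials)
  have "card W \<le> (M * N * length xs + 1) ^ d"
    unfolding W_def d_def using assms(1) by (rule card_bounded_monomials)
  also have "\<dots> \<le> (A * (N + 1)) ^ d"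
    by (rule power_mono) (simp_all add: A_def assms(2) d_def algebra_simps)
  also have "\<dots> = N * (N + 1) ^ d"
    by (simp only: power_mult_distrib N_def)
  also have "\<dots> < (N + 1) * (N + 1) ^ d"
    by simp
  also have "\<dots> = card ?X" by (simp add: card_exponent_lists assms(2) d_def)
  finally have less: "card W < card ?X" .
  show ?thesis
  \<comment> \<open>two equal power products already form a relation; distinct ones are a set of vectors\<close>
  proof (cases "inj_on (powprod xs) ?X")
    case False
    then obtain a b where ab: "a \<in> ?X" "b \<in> ?X" "a \<noteq> b" "powprod xs a = powprod xs b"
      by (auto simp: inj_on_def)
    define c where "c es = (if es = a then 1 else if es = b then - 1 else 0 :: 'k)" for es
    have "(\<Sum>es\<in>?X. Poly_Mapping.single 0 (c es) * powprod xs es) =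
        (\<Sum>es\<in>{a, b}. Poly_Mapping.single 0 (c es) * powprod xs es)"
      by (rule sum.mono_neutral_right) (use ab finite_exponent_lists in \<open>auto simp: c_def\<close>)
    also have "\<dots> = 0" using ab by (simp add: c_def single_uminus)
    finally show ?thesis using that[where es = a and N = N and c = c] ab(1) by (simp add: c_def)
  next
    case True
    interpret vs: vector_space "\<lambda>(c :: 'k) (p :: ('v, 'k) mpoly). Poly_Mapping.single 0 c * p"
      by unfold_locales (simp_all add: algebra_simps single_add mult_single flip: mult.assoc)
    let ?B = "(\<lambda>w. Poly_Mapping.single w (1 :: 'k)) ` W"
    have "powprod xs ` ?X \<subseteq> vs.span ?B"
    proof
      fix p assume "p \<in> powprod xs ` ?X"
      then have keys: "Poly_Mapping.keys p \<subseteq> W"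
        using keys_powprod_bounded[OF M] by (auto simp: W_def)
      have "(\<Sum>m\<in>Poly_Mapping.keys p. Poly_Mapping.single 0 (Poly_Mapping.lookup p m) * Poly_Mapping.single m 1) \<in> vs.span ?B"
        using keys by (intro vs.span_sum vs.span_scale vs.span_base) auto
      then show "p \<in> vs.span ?B" by (simp add: mult_single sum_monomials)
    qed
    moreover have "card ?B < card (powprod xs ` ?X)"
      using less card_image[OF True] card_image_le[OF finW, of "\<lambda>w. Poly_Mapping.single w (1 :: 'k)"] by simp
    ultimately have "\<not> vs.independent (powprod xs ` ?X)"
      using vs.independent_span_bound[of ?B "powprod xs ` ?X"] finW by auto
    then obtain u v where uv: "v \<in> powprod xs ` ?X" "u v \<noteq> 0"
      "(\<Sum>v\<in>powprod xs ` ?X. Poly_Mapping.single 0 (u v) * v) = 0"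
      by (subst (asm) vs.dependent_finite) (use finite_exponent_lists in auto)
    then obtain es where es: "es \<in> ?X" "v = powprod xs es" by blast
    show ?thesis
      by (rule that[where es = es and N = N and c = "\<lambda>es. u (powprod xs es)"]) (use es uv True in \<open>simp_all add: sum.reindex\<close>)
  qed
qed

theorem prime_chain_length_le:
  fixes B :: "('v, 'k::field) mpoly set"
  assumes "finite V"
    and "B \<subseteq> carrier (mpoly_ring V)"
    and "\<And>c. Poly_Mapping.single 0 c \<in> B"
    and primes: "\<And>i. i \<le> l \<Longrightarrow> primeideal (P i) ((mpoly_ring V)\<lparr>carrier := B\<rparr>)"
    and strict: "\<And>i. i < l \<Longrightarrow> P i \<subset> P (Suc i)"
  shows "l \<le> card V"
proof (rule ccontr)
  assume "\<not> l \<le> card V"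
  then have l: "Suc (card V) \<le> l" by simp
  define x where "x i = (SOME x. x \<in> P (Suc i) - P i)" for i
  have x: "x i \<in> P (Suc i) - P i" if "i < l" for i
    unfolding x_def using strict[OF that] by (metis someI_ex Diff_iff psubset_imp_ex_mem)
  define xs where "xs = map x [0..<Suc (card V)]"
  have len: "length xs = Suc (card V)" by (simp add: xs_def)
  have step: "xs ! i \<in> P (Suc i) - P i" if "i < length xs" for i
    using x[of i] that l unfolding xs_def by (simp del: upt_Suc)
  have "set xs \<subseteq> B"
  proof
    fix z assume "z \<in> set xs"
    then obtain i where i: "i < length xs" "z = xs ! i" by (metis in_set_conv_nth)
    interpret primeideal "P (Suc i)" "(mpoly_ring V)\<lparr>carrier := B\<rparr>"
      using primes i(1) len l by simp
    show "z \<in> B" using step[OF i(1)] i(2) Icarr by simp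
  qed
  then have "set xs \<subseteq> carrier (mpoly_ring V)" using assms(2) by blast
  then obtain N c es where dep: "es \<in> exponent_lists N (length xs)" "c es \<noteq> 0"
    "(\<Sum>es\<in>exponent_lists N (length xs). Poly_Mapping.single 0 (c es) * powprod xs es) = 0"
    by (rule algebraically_dependent[OF assms(1) len])
  interpret primeideal "P 0" "(mpoly_ring V)\<lparr>carrier := B\<rparr>" using primes by simp
  have "0 \<in> P 0" using additive_subgroup.zero_closed[OF is_additive_subgroup] by simp
  have "c es = 0"
  proof (rule prime_chain_independent[where B = B and xs = xs and P = P and V = V and N = N and c = c and es = es])
    show "primeideal (P i) ((mpoly_ring V)\<lparr>carrier := B\<rparr>)" if "i \<le> length xs" for i
      using primes that len l by simp
    show "P i \<subseteq> P (Suc i)" if "i < length xs" for i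
      using strict that len l by (simp add: psubset_eq)
    show "(\<Sum>es\<in>exponent_lists N (length xs). Poly_Mapping.single 0 (c es) * powprod xs es) \<in> P 0"
      using dep(3) \<open>0 \<in> P 0\<close> by simp
    show "xs ! i \<in> P (Suc i) - P i" if "i < length xs" for i
      using that by (rule step)
  qed (rule assms(3), rule dep(1))
  then show False using dep(2) by simp
qed

section \<open>Linear extension of maps on monomials\<close>

definition linear_extension :: "('m \<Rightarrow> ('n::comm_monoid_add \<Rightarrow>\<^sub>0 'k)) \<Rightarrow> ('m \<Rightarrow>\<^sub>0 'k) \<Rightarrow> ('n \<Rightarrow>\<^sub>0 'k::comm_ring_1)" where
  "linear_extension h p = (\<Sum>m\<in>Poly_Mapping.keys p. Poly_Mapping.single 0 (Poly_Mapping.lookup p m) * h m)"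

lemma linear_extension_superset:
  assumes "finite M" "Poly_Mapping.keys p \<subseteq> M"
  shows "linear_extension h p = (\<Sum>m\<in>M. Poly_Mapping.single 0 (Poly_Mapping.lookup p m) * h m)"
  unfolding linear_extension_def by (rule sum.mono_neutral_left) (use assms in \<open>auto simp: in_keys_iff\<close>)

lemma linear_extension_0 [simp]: "linear_extension h 0 = 0"
  by (simp add: linear_extension_def)

lemma linear_extension_single [simp]: "linear_extension h (Poly_Mapping.single m c) = Poly_Mapping.single 0 c * h m"
  by (cases "c = 0") (simp_all add: linear_extension_def)

lemma linear_extension_add: "linear_extension h (p + q) = linear_extension h p + linear_extension h q"
proof -
  let ?M = "Poly_Mapping.keys p \<union> Poly_Mapping.keys q"
  have "linear_extension h r = (\<Sum>m\<in>?M. Poly_Mapping.single 0 (Poly_Mapping.lookup r m) * h m)"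
    if "Poly_Mapping.keys r \<subseteq> ?M" for r
    using that by (intro linear_extension_superset) auto
  then show ?thesis
    using keys_add[of p q] by (simp add: lookup_add single_add algebra_simps sum.distrib)
qed

lemma linear_extension_sum: "linear_extension h (\<Sum>i\<in>I. f i) = (\<Sum>i\<in>I. linear_extension h (f i))"
  by (induction I rule: infinite_finite_induct) (simp_all add: linear_extension_add)

text \<open>
  Three different maps are allowed because the maps of interest also depend on the power of \<open>t\<close> to
  which the polynomials are attached. Multiplicativity is required only on the monomials that occur, as
  the map onto the lowest part is not multiplicative on all of \<open>S[t]\<close>.
\<close>

lemma linear_extension_times:
  fixes f g h :: "'m::comm_monoid_add \<Rightarrow> ('n::comm_monoid_add \<Rightarrow>\<^sub>0 'k::comm_ring_1)"
  assumes "\<And>m m'. m \<in> Poly_Mapping.keys p \<Longrightarrow> m' \<in> Poly_Mapping.keys q \<Longrightarrow> h (m + m') = f m * g m'"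
  shows "linear_extension h (p * q) = linear_extension f p * linear_extension g q"
proof -
  let ?s = "\<lambda>p m. Poly_Mapping.single m (Poly_Mapping.lookup p m)"
  have "p * q = (\<Sum>m\<in>Poly_Mapping.keys p. \<Sum>m'\<in>Poly_Mapping.keys q. ?s p m * ?s q m')"
    by (simp only: sum_product[symmetric] sum_monomials)
  then have "linear_extension h (p * q) = (\<Sum>m\<in>Poly_Mapping.keys p. \<Sum>m'\<in>Poly_Mapping.keys q.
      Poly_Mapping.single 0 (Poly_Mapping.lookup p m * Poly_Mapping.lookup q m') * h (m + m'))"
    by (simp add: linear_extension_sum mult_single)
  also have "\<dots> = (\<Sum>m\<in>Poly_Mapping.keys p. \<Sum>m'\<in>Poly_Mapping.keys q.
      (Poly_Mapping.single 0 (Poly_Mapping.lookup p m) * f m) * (Poly_Mapping.single 0 (Poly_Mapping.lookup q m') * g m'))"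
  proof (intro sum.cong refl)
    fix m m' assume "m \<in> Poly_Mapping.keys p" "m' \<in> Poly_Mapping.keys q"
    have "Poly_Mapping.single 0 (a * b) = Poly_Mapping.single 0 a * Poly_Mapping.single (0::'n) b" for a b :: 'k
      by (simp add: mult_single)
    then show "Poly_Mapping.single 0 (Poly_Mapping.lookup p m * Poly_Mapping.lookup q m') * h (m + m') =
        (Poly_Mapping.single 0 (Poly_Mapping.lookup p m) * f m) * (Poly_Mapping.single 0 (Poly_Mapping.lookup q m') * g m')"
      using assms[OF \<open>m \<in> _\<close> \<open>m' \<in> _\<close>] by (simp add: mult_ac)
  qed
  finally show ?thesis by (simp only: linear_extension_def sum_product)
qed

definition poly_linear_extension ::
    "(nat \<Rightarrow> 'm \<Rightarrow> ('n::comm_monoid_add \<Rightarrow>\<^sub>0 'k)) \<Rightarrow> ('m \<Rightarrow>\<^sub>0 'k) poly \<Rightarrow> ('n \<Rightarrow>\<^sub>0 'k::comm_ring_1)" where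
  "poly_linear_extension h f = (\<Sum>k\<le>degree f. linear_extension (h k) (poly.coeff f k))"

lemma poly_linear_extension_bound:
  assumes "degree f \<le> K"
  shows "poly_linear_extension h f = (\<Sum>k\<le>K. linear_extension (h k) (poly.coeff f k))"
  unfolding poly_linear_extension_def
  by (rule sum.mono_neutral_left) (use assms in \<open>auto simp: coeff_eq_0\<close>)

lemma poly_linear_extension_add: "poly_linear_extension h (f + g) = poly_linear_extension h f + poly_linear_extension h g"
proof -
  let ?K = "max (degree f) (degree g)"
  have "poly_linear_extension h f = (\<Sum>k\<le>?K. linear_extension (h k) (poly.coeff f k))"
    "poly_linear_extension h g = (\<Sum>k\<le>?K. linear_extension (h k) (poly.coeff g k))"
    "poly_linear_extension h (f + g) = (\<Sum>k\<le>?K. linear_extension (h k) (poly.coeff (f + g) k))"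
    using degree_add_le_max[of f g] by (intro poly_linear_extension_bound; simp)+
  then show ?thesis by (simp add: linear_extension_add sum.distrib)
qed

lemma poly_linear_extension_0 [simp]: "poly_linear_extension h 0 = 0"
  by (simp add: poly_linear_extension_def)

lemma poly_linear_extension_sum: "poly_linear_extension h (\<Sum>i\<in>I. f i) = (\<Sum>i\<in>I. poly_linear_extension h (f i))"
  by (induction I rule: infinite_finite_induct) (simp_all add: poly_linear_extension_add)

lemma poly_linear_extension_monom [simp]: "poly_linear_extension h (monom p k) = linear_extension (h k) p"
proof -
  have "poly_linear_extension h (monom p k) = (\<Sum>i\<le>k. linear_extension (h i) (poly.coeff (monom p k) i))"
    by (rule poly_linear_extension_bound) (rule degree_monom_le)
  also have "\<dots> = (\<Sum>i\<le>k. if i = k then linear_extension (h k) p else 0)"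
    by (intro sum.cong) auto
  finally show ?thesis by simp
qed

lemma poly_linear_extension_times:
  fixes f g :: "('m::comm_monoid_add \<Rightarrow>\<^sub>0 'k::comm_ring_1) poly"
  assumes "\<And>i j m m'. m \<in> Poly_Mapping.keys (poly.coeff f i) \<Longrightarrow> m' \<in> Poly_Mapping.keys (poly.coeff g j)
    \<Longrightarrow> h (i + j) (m + m') = h i m * h j m'"
  shows "poly_linear_extension h (f * g) = poly_linear_extension h f * poly_linear_extension h g"
proof -
  have "f * g = (\<Sum>i\<le>degree f. monom (poly.coeff f i) i) * (\<Sum>j\<le>degree g. monom (poly.coeff g j) j)"
    by (simp only: poly_as_sum_of_monoms)
  also have "\<dots> = (\<Sum>i\<le>degree f. \<Sum>j\<le>degree g. monom (poly.coeff f i * poly.coeff g j) (i + j))"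
    by (simp add: sum_product mult_monom)
  finally have "poly_linear_extension h (f * g) =
      (\<Sum>i\<le>degree f. \<Sum>j\<le>degree g. linear_extension (h (i + j)) (poly.coeff f i * poly.coeff g j))"
    by (simp add: poly_linear_extension_sum)
  also have "\<dots> = (\<Sum>i\<le>degree f. \<Sum>j\<le>degree g. linear_extension (h i) (poly.coeff f i) * linear_extension (h j) (poly.coeff g j))"
    by (intro sum.cong refl linear_extension_times assms)
  finally show ?thesis by (simp add: poly_linear_extension_def sum_product)
qed

section \<open>The dimension of subalgebras of polynomial rings\<close>

definition indicator_monomial :: "'v set \<Rightarrow> 'v \<Rightarrow>\<^sub>0 nat" where
  "indicator_monomial C = (\<Sum>v\<in>C. Poly_Mapping.single v 1)"

lemma lookup_indicator_monomial:
  assumes "finite C"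
  shows "Poly_Mapping.lookup (indicator_monomial C) v = (if v \<in> C then 1 else 0)"
proof -
  have "Poly_Mapping.lookup (indicator_monomial C) v = (\<Sum>w\<in>C. if w = v then 1 else 0)"
    by (simp add: indicator_monomial_def lookup_sum lookup_single when_def del: One_nat_def)
  then show ?thesis using assms by simp
qed

lemma keys_indicator_monomial: "finite C \<Longrightarrow> Poly_Mapping.keys (indicator_monomial C) = C"
  by (auto simp: in_keys_iff lookup_indicator_monomial split: if_splits)

lemma cover_monomial_eq: "cover_monomial C = Poly_Mapping.single (indicator_monomial C) (1::'k::field)"
  by (induction C rule: infinite_finite_induct)
    (simp_all add: cover_monomial_def indicator_monomial_def mvar_def mult_single)

lemma (in cring) cring_subring: "subring B R \<Longrightarrow> cring (R\<lparr>carrier := B\<rparr>)"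
  using subcring_iff[OF subringE(1)] subcringI' by blast

text \<open>
  The monomials in the variables \<open>W\<close> are a face of the monoid of all monomials: a product lies in it
  only if both factors do. Sending the other variables to zero is therefore a homomorphism into a
  domain, and this is its kernel on \<open>B\<close>.
\<close>

definition off_face :: "('v, 'k::field) mpoly set \<Rightarrow> 'v set \<Rightarrow> ('v, 'k) mpoly set" where
  "off_face B W = {p \<in> B. \<forall>m\<in>Poly_Mapping.keys p. \<not> Poly_Mapping.keys m \<subseteq> W}"

text \<open>
  A linear order on the variables extends to the monomials and makes the polynomial ring a domain;
  the ideal is the kernel of a homomorphism into it.
\<close>

lemma primeideal_off_face:
  fixes B :: "('v::linorder, 'k::field) mpoly set"
  assumes "subring B (mpoly_ring V)"
  shows "primeideal (off_face B W) ((mpoly_ring V)\<lparr>carrier := B\<rparr>)" (is "primeideal _ ?R")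
proof -
  define h where "h m = (if Poly_Mapping.keys m \<subseteq> W then Poly_Mapping.single m (1::'k) else 0)"
    for m :: "'v \<Rightarrow>\<^sub>0 nat"
  have h_add: "h (m + m') = h m * h m'" for m m'
    by (simp add: h_def keys_plus_nat mult_single)
  have mult: "linear_extension h (p * q) = linear_extension h p * linear_extension h q" for p q
    by (rule linear_extension_times) (rule h_add)
  have lookup: "Poly_Mapping.lookup (linear_extension h p) m = (if Poly_Mapping.keys m \<subseteq> W then Poly_Mapping.lookup p m else 0)" for p m
  proof -
    have "Poly_Mapping.lookup (linear_extension h p) m =
        (\<Sum>m'\<in>Poly_Mapping.keys p. if m' = m then (if Poly_Mapping.keys m \<subseteq> W then Poly_Mapping.lookup p m else 0) else 0)"
      unfolding linear_extension_def lookup_sum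
      by (intro sum.cong) (auto simp: h_def mult_single lookup_single when_def)
    also have "\<dots> = (if Poly_Mapping.keys m \<subseteq> W then Poly_Mapping.lookup p m else 0)"
      by (simp add: in_keys_iff)
    finally show ?thesis .
  qed
  have iff: "p \<in> off_face B W \<longleftrightarrow> p \<in> B \<and> linear_extension h p = 0" for p
    by (auto simp: off_face_def poly_mapping_eq_iff fun_eq_iff lookup in_keys_iff split: if_splits)
  have one: "linear_extension h 1 = 1"
    using linear_extension_single[of h 0 1] by (simp add: h_def)
  have cring: "cring ?R"
    using cring_mpoly_ring assms by (rule cring.cring_subring)
  let ?T = "mpoly_ring UNIV :: ('v, 'k) mpoly ring"
  interpret T: cring ?T by (rule cring_mpoly_ring)
  have domain: "domain ?T"
    by (rule domainI) (simp_all add: cring_mpoly_ring)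
  interpret ring_hom_ring ?R ?T "linear_extension h"
    by (rule ring_hom_ringI2)
      (use cring in \<open>auto simp: cring_def T.ring_axioms mult one linear_extension_add ring_hom_def mpoly_ring_carrier\<close>)
  have "primeideal {p \<in> carrier ?R. linear_extension h p \<in> {\<zero>\<^bsub>?T\<^esub>}} ?R"
    using cring domain.zeroprimeideal[OF domain] by (rule primeideal_vimage)
  moreover have "off_face B W = {p \<in> carrier ?R. linear_extension h p \<in> {\<zero>\<^bsub>?T\<^esub>}}"
    using iff by auto
  ultimately show ?thesis by simp
qed

text \<open>
  The upper bound is \<open>prime_chain_length_le\<close>. For the lower bound, the products \<open>z\<^sub>0 \<cdots> z\<^sub>s\<close> make sure that the chain of
  primes obtained by sending the last variables to zero, one more at each step, stays strict in \<open>B\<close>: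
  the product lies in the next prime as soon as \<open>z\<^sub>s\<close> is sent to zero, but not before.
\<close>

theorem krull_dim_subalgebra:
  fixes B :: "(nat, 'k::field) mpoly set"
  assumes subring: "subring B (mpoly_ring {..<d})"
    and const: "\<And>c. Poly_Mapping.single 0 c \<in> B"
    and initial: "\<And>s. s < d \<Longrightarrow> cover_monomial {..s} \<in> B"
  shows "krull_dim ((mpoly_ring {..<d})\<lparr>carrier := B\<rparr>) = enat d" (is "krull_dim ?R = _")
proof (rule antisym)
  show "krull_dim ?R \<le> enat d"
    unfolding krull_dim_def
  proof (rule Sup_least, clarify)
    fix l and P :: "nat \<Rightarrow> (nat, 'k) mpoly set"
    assume "\<forall>i\<le>l. primeideal (P i) ?R" "\<forall>i<l. P i \<subset> P (Suc i)"
    then have "l \<le> card {..<d}"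
      using subringE(1)[OF subring] const by (intro prime_chain_length_le[of _ B l P]) auto
    then show "enat l \<le> enat d" by simp
  qed
next
  define P where "P i = off_face B {..<d - i}" for i
  have "P i \<subset> P (Suc i)" if "i < d" for i
  proof -
    define s where "s = d - Suc i"
    have s: "d - i = Suc s" "d - Suc i = s" "s < d" using that by (auto simp: s_def)
    have "P i \<subseteq> P (Suc i)"
      unfolding P_def off_face_def s by fastforce
    moreover have "cover_monomial {..s} \<in> P (Suc i) - P i"
      using initial[OF s(3)]
      by (auto simp: P_def s off_face_def cover_monomial_eq keys_indicator_monomial)
    ultimately show ?thesis by blast
  qed
  moreover have "primeideal (P i) ?R" for i
    unfolding P_def using subring by (rule primeideal_off_face)
  ultimately show "enat d \<le> krull_dim ?R"
    unfolding krull_dim_def by (intro Sup_upper) blast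
qed

section \<open>Krull dimension and ring homomorphisms\<close>

text \<open>
  Preimages of prime ideals are prime, and surjectivity keeps the inclusions strict.
\<close>

lemma krull_dim_le_of_surj:
  assumes "cring R" "cring S" "h \<in> ring_hom R S" and surj: "h ` carrier R = carrier S"
  shows "krull_dim S \<le> krull_dim R"
  unfolding krull_dim_def
proof (rule Sup_least, clarify)
  fix l P assume P: "\<forall>i\<le>l. primeideal (P i) S" "\<forall>i<l. P i \<subset> P (Suc i)"
  interpret R: cring R by fact
  interpret S: cring S by fact
  interpret ring_hom_ring R S h
    by (rule ring_hom_ringI2) (use assms R.ring_axioms S.ring_axioms in auto)
  define Q where "Q i = {r \<in> carrier R. h r \<in> P i}" for i
  have "primeideal (Q i) R" if "i \<le> l" for i
    unfolding Q_def using assms(1) P(1) that by (intro primeideal_vimage) auto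
  moreover have "Q i \<subset> Q (Suc i)" if "i < l" for i
  proof -
    have "P i \<subset> P (Suc i)" using P(2) that by blast
    then obtain y where y: "y \<in> P (Suc i)" "y \<notin> P i" by blast
    interpret primeideal "P (Suc i)" S using P(1) that by simp
    obtain x where "x \<in> carrier R" "h x = y" using Icarr[OF y(1)] surj by (metis imageE)
    then show ?thesis using \<open>P i \<subset> P (Suc i)\<close> y by (auto simp: Q_def)
  qed
  ultimately show "enat l \<le> Sup {enat l |l. \<exists>P. (\<forall>i\<le>l. primeideal (P i) R) \<and> (\<forall>i<l. P i \<subset> P (Suc i))}"
    by (intro Sup_upper) blast
qed

lemma krull_dim_ring_iso:
  assumes "cring R" "cring S" "h \<in> ring_iso R S"
  shows "krull_dim R = krull_dim S"
proof (rule antisym)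
  interpret R: cring R by fact
  interpret S: cring S by fact
  have "inv_into (carrier R) h \<in> ring_iso S R"
    using assms(3) R.ring_axioms by (rule ring_iso_set_sym[rotated])
  then show "krull_dim R \<le> krull_dim S"
    using assms by (intro krull_dim_le_of_surj) (auto simp: ring_iso_def bij_betw_def)
  show "krull_dim S \<le> krull_dim R"
    using assms by (intro krull_dim_le_of_surj) (auto simp: ring_iso_def bij_betw_def)
qed

lemma krull_dim_Quot_kernel:
  assumes "cring R" "cring S" "h \<in> ring_hom R S"
  shows "krull_dim (R Quot a_kernel R S h) = krull_dim (S\<lparr>carrier := h ` carrier R\<rparr>)"
proof -
  interpret R: cring R by fact
  interpret S: cring S by fact
  interpret ring_hom_ring R S h
    by (rule ring_hom_ringI2) (use assms R.ring_axioms S.ring_axioms in auto)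
  have "cring (R Quot a_kernel R S h)"
    using kernel_is_ideal assms(1) by (rule ideal.quotient_is_cring)
  moreover have "cring (S\<lparr>carrier := h ` carrier R\<rparr>)"
    using img_is_subring[OF R.carrier_is_subring] by (rule S.cring_subring)
  ultimately show ?thesis
    using FactRing_iso_set_aux by (rule krull_dim_ring_iso)
qed

section \<open>The monomials of the vertex cover algebra\<close>

text \<open>
  The pairs of \<open>k\<close> and the exponent of \<open>u\<^sub>C\<^sub>1 \<cdots> u\<^sub>C\<^sub>k\<close> for members \<open>C\<^sub>1,\<dots>,C\<^sub>k\<close> of the family.
\<close>

inductive_set cover_products :: "'v set set \<Rightarrow> (nat \<times> ('v \<Rightarrow>\<^sub>0 nat)) set" for \<C> where
  zero: "(0, 0) \<in> cover_products \<C>"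
| Suc: "(k, m) \<in> cover_products \<C> \<Longrightarrow> C \<in> \<C> \<Longrightarrow> (Suc k, indicator_monomial C + m) \<in> cover_products \<C>"

lemma cover_products_single: "C \<in> \<C> \<Longrightarrow> (1, indicator_monomial C) \<in> cover_products \<C>"
  using cover_products.Suc[OF cover_products.zero, of C \<C>] by simp

lemma cover_products_add:
  assumes "(k, m) \<in> cover_products \<C>" "(k', m') \<in> cover_products \<C>"
  shows "(k + k', m + m') \<in> cover_products \<C>"
  using assms by (induction rule: cover_products.induct)
    (auto simp: add.assoc intro: cover_products.Suc)

text \<open>
  The pairs \<open>(k, m)\<close> such that \<open>m t\<^sup>k\<close> is a monomial of the algebra generated by \<open>S\<close> and the \<open>u\<^sub>C t\<close>.
\<close>

definition algebra_monomials :: "'v set \<Rightarrow> 'v set set \<Rightarrow> (nat \<times> ('v \<Rightarrow>\<^sub>0 nat)) set" where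
  "algebra_monomials V \<C> = {(k, w + m) | k w m. Poly_Mapping.keys w \<subseteq> V \<and> (k, m) \<in> cover_products \<C>}"

lemma algebra_monomialsI:
  "Poly_Mapping.keys w \<subseteq> V \<Longrightarrow> (k, m) \<in> cover_products \<C> \<Longrightarrow> (k, w + m) \<in> algebra_monomials V \<C>"
  by (auto simp: algebra_monomials_def)

lemma algebra_monomialsE:
  assumes "(k, m) \<in> algebra_monomials V \<C>"
  obtains w a where "m = w + a" "Poly_Mapping.keys w \<subseteq> V" "(k, a) \<in> cover_products \<C>"
  using assms by (auto simp: algebra_monomials_def)

lemma algebra_monomials_add:
  assumes "(k, m) \<in> algebra_monomials V \<C>" "(k', m') \<in> algebra_monomials V \<C>"
  shows "(k + k', m + m') \<in> algebra_monomials V \<C>"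
proof -
  obtain w a where w: "m = w + a" "Poly_Mapping.keys w \<subseteq> V" "(k, a) \<in> cover_products \<C>"
    using assms(1) by (rule algebra_monomialsE)
  obtain w' a' where w': "m' = w' + a'" "Poly_Mapping.keys w' \<subseteq> V" "(k', a') \<in> cover_products \<C>"
    using assms(2) by (rule algebra_monomialsE)
  have "m + m' = (w + w') + (a + a')" using w w' by (simp add: add_ac)
  then show ?thesis
    using algebra_monomialsI[OF _ cover_products_add[OF w(3) w'(3)], of "w + w'" V] w(2) w'(2)
    by (simp add: keys_plus_nat)
qed

lemma cover_products_subset_algebra_monomials:
  "(k, m) \<in> cover_products \<C> \<Longrightarrow> (k, m) \<in> algebra_monomials V \<C>"
  using algebra_monomialsI[of 0] by simp

lemma keys_algebra_monomials:
  assumes "finite V" "\<And>C. C \<in> \<C> \<Longrightarrow> C \<subseteq> V" "(k, m) \<in> algebra_monomials V \<C>"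
  shows "Poly_Mapping.keys m \<subseteq> V"
proof -
  have "Poly_Mapping.keys m \<subseteq> V" if "(k, m) \<in> cover_products \<C>" for k m
    using that
  proof (induction rule: cover_products.induct)
    case (Suc k m C)
    have "C \<subseteq> V" using Suc(2) assms(2) by blast
    moreover have "finite C" using \<open>C \<subseteq> V\<close> assms(1) by (rule finite_subset)
    ultimately show ?case using Suc(3) by (simp add: keys_plus_nat keys_indicator_monomial)
  qed simp
  then show ?thesis using assms(3) by (elim algebra_monomialsE) (simp add: keys_plus_nat)
qed

lemma poly_sum_monomials:
  fixes f :: "('m, 'k::comm_monoid_add) poly_mapping poly"
  shows "(\<Sum>k\<le>degree f. \<Sum>m\<in>Poly_Mapping.keys (poly.coeff f k).
    monom (Poly_Mapping.single m (Poly_Mapping.lookup (poly.coeff f k) m)) k) = f"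
proof -
  have "(\<Sum>m\<in>Poly_Mapping.keys p. monom (Poly_Mapping.single m (Poly_Mapping.lookup p m)) k) = monom p k"
    for p :: "'m \<Rightarrow>\<^sub>0 'k" and k
  proof -
    have "monom (\<Sum>m\<in>M. g m) k = (\<Sum>m\<in>M. monom (g m) k)" for M :: "'m set" and g :: "'m \<Rightarrow> ('m \<Rightarrow>\<^sub>0 'k)"
      by (induction M rule: infinite_finite_induct) (simp_all flip: add_monom)
    then show ?thesis by (simp flip: \<open>_\<close> add: sum_monomials)
  qed
  then show ?thesis by (simp add: poly_as_sum_of_monoms)
qed

lemma minimal_vertex_coversD:
  "C \<in> minimal_vertex_covers V E \<Longrightarrow> vertex_cover V E C"
  "C \<in> minimal_vertex_covers V E \<Longrightarrow> C \<subseteq> V"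
  by (auto simp: minimal_vertex_covers_def vertex_cover_def)

lemma vertex_cover_algebra_simps [simp]:
  "f \<otimes>\<^bsub>vertex_cover_algebra V E\<^esub> g = f * g" "f \<oplus>\<^bsub>vertex_cover_algebra V E\<^esub> g = f + g"
  "\<one>\<^bsub>vertex_cover_algebra V E\<^esub> = 1" "\<zero>\<^bsub>vertex_cover_algebra V E\<^esub> = 0"
  by (simp_all add: vertex_cover_algebra_def)

text \<open>
  The algebra is generated by terms, so it is spanned over \<open>K\<close> by the monomials that it contains, and
  membership can be tested monomial by monomial.
\<close>

lemma vertex_cover_algebra:
  assumes "finite V"
  shows cring_vertex_cover_algebra: "cring (vertex_cover_algebra V E :: ('v, 'k::field) mpoly poly ring)" (is "cring ?A")
    and carrier_vertex_cover_algebra: "carrier (vertex_cover_algebra V E :: ('v, 'k::field) mpoly poly ring) =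
      {f. \<forall>k. \<forall>m\<in>Poly_Mapping.keys (poly.coeff f k). (k, m) \<in> algebra_monomials V (minimal_vertex_covers V E)}"
      (is "_ = ?F")
proof -
  let ?R = "mpoly_ring_t V :: ('v, 'k) mpoly poly ring"
  let ?M = "algebra_monomials V (minimal_vertex_covers V E)"
  define H where "H = (\<lambda>s. [:s:]) ` carrier (mpoly_ring V :: ('v, 'k) mpoly ring) \<union>
        (\<lambda>C. monom (cover_monomial C) 1) ` minimal_vertex_covers V E"
  have A: "?A = ?R\<lparr>carrier := generate_ring ?R H\<rparr>"
    unfolding vertex_cover_algebra_def H_def ..
  have carrA: "carrier ?A = generate_ring ?R H" by (simp add: A)
  interpret R: cring ?R by (rule cring_mpoly_ring_t)
  have FR: "?F \<subseteq> carrier ?R"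
  proof
    fix f :: "('v, 'k) mpoly poly" assume f: "f \<in> ?F"
    have "Poly_Mapping.keys m \<subseteq> V" if "m \<in> Poly_Mapping.keys (poly.coeff f k)" for k m
    proof (rule keys_algebra_monomials[OF assms minimal_vertex_coversD(2)])
      show "(k, m) \<in> ?M" using f that by simp
    qed
    then show "f \<in> carrier ?R" by (simp add: mpoly_ring_t_carrier mpoly_ring_carrier)
  qed
  have M0: "(0, w) \<in> ?M" if "Poly_Mapping.keys w \<subseteq> V" for w
    using algebra_monomialsI[OF that cover_products.zero] by simp
  have HF: "H \<subseteq> ?F"
  proof -
    have "[:s:] \<in> ?F" if "s \<in> carrier (mpoly_ring V)" for s :: "('v, 'k) mpoly"
      using that M0 by (auto simp: mpoly_ring_carrier coeff_pCons split: nat.splits)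
    moreover have "monom (cover_monomial C) 1 \<in> ?F" if "C \<in> minimal_vertex_covers V E" for C
      using cover_products_subset_algebra_monomials[OF cover_products_single[OF that]]
      by (auto simp: cover_monomial_eq coeff_monom)
    ultimately show ?thesis by (auto simp: H_def)
  qed
  then have HR: "H \<subseteq> carrier ?R" using FR by blast
  have subF: "subring ?F ?R"
  proof (rule R.subringI)
    show "?F \<subseteq> carrier ?R" by (rule FR)
    show "\<one>\<^bsub>?R\<^esub> \<in> ?F" using M0[of 0] by (auto simp: coeff_1)
    fix f assume f: "f \<in> ?F"
    moreover have "\<ominus>\<^bsub>?R\<^esub> f = - f" using f FR mpoly_ring_t_minus by blast
    ultimately show "\<ominus>\<^bsub>?R\<^esub> f \<in> ?F" by simp
    fix g assume g: "g \<in> ?F"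
    show "f \<oplus>\<^bsub>?R\<^esub> g \<in> ?F"
    proof -
      have "Poly_Mapping.keys (poly.coeff (f + g) k) \<subseteq> Poly_Mapping.keys (poly.coeff f k) \<union> Poly_Mapping.keys (poly.coeff g k)" for k
        using keys_add by simp
      then show ?thesis using f g by fastforce
    qed
    have "(k, m) \<in> ?M" if "m \<in> Poly_Mapping.keys (poly.coeff (f * g) k)" for k m
    proof -
      have "m \<in> (\<Union>i\<le>k. Poly_Mapping.keys (poly.coeff f i * poly.coeff g (k - i)))"
        using that keys_sum unfolding coeff_mult by fast
      then obtain i where i: "i \<le> k" "m \<in> Poly_Mapping.keys (poly.coeff f i * poly.coeff g (k - i))" by blast
      then obtain a b where ab: "a \<in> Poly_Mapping.keys (poly.coeff f i)"
        "b \<in> Poly_Mapping.keys (poly.coeff g (k - i))" "m = a + b"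
        by (elim keys_times_subset)
      then have "(i, a) \<in> ?M" "(k - i, b) \<in> ?M" using f g by auto
      from algebra_monomials_add[OF this] show ?thesis using i ab by simp
    qed
    then show "f \<otimes>\<^bsub>?R\<^esub> g \<in> ?F" by simp
  qed
  have subA: "subring (generate_ring ?R H) ?R"
    using HR by (rule R.generate_ring_is_subring)
  show "cring ?A" unfolding A using subA by (rule R.cring_subring)
  have monom1: "monom (Poly_Mapping.single m 1) k \<in> generate_ring ?R H"
    if "(k, m) \<in> cover_products (minimal_vertex_covers V E)" for k m
    using that
  proof (induction rule: cover_products.induct)
    case zero
    then show ?case using generate_ring.one[of ?R H] by (simp add: monom_0 one_pCons)
  next
    case (Suc k m C)
    have "monom (cover_monomial C) 1 \<in> generate_ring ?R H"
      using Suc(2) by (intro generate_ring.incl) (auto simp: H_def)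
    from generate_ring.eng_mult[OF this Suc(3)] show ?case
      by (simp add: mult_monom cover_monomial_eq mult_single)
  qed
  have monom: "monom (Poly_Mapping.single m c) k \<in> generate_ring ?R H" if "(k, m) \<in> ?M" for k m c
  proof -
    obtain w a where w: "m = w + a" "Poly_Mapping.keys w \<subseteq> V" "(k, a) \<in> cover_products (minimal_vertex_covers V E)"
      using \<open>(k, m) \<in> ?M\<close> by (rule algebra_monomialsE)
    have "[:Poly_Mapping.single w c:] \<in> generate_ring ?R H"
      using w(2) by (intro generate_ring.incl) (auto simp: H_def mpoly_ring_carrier)
    from generate_ring.eng_mult[OF this monom1[OF w(3)]] show ?thesis
      by (simp add: w(1) mult_single smult_monom)
  qed
  have sum: "(\<Sum>i\<in>I. p i) \<in> generate_ring ?R H" if "\<And>i. i \<in> I \<Longrightarrow> p i \<in> generate_ring ?R H"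
    for I :: "'i set" and p
    using that subringE(2,7)[OF subA] by (induction I rule: infinite_finite_induct) auto
  show "carrier ?A = ?F"
    unfolding carrA
  proof (rule equalityI)
    show "generate_ring ?R H \<subseteq> ?F" using HR subF HF by (rule R.generate_ring_min_subring1)
    show "?F \<subseteq> generate_ring ?R H"
    proof
      fix f assume "f \<in> ?F"
      then have "(\<Sum>k\<le>degree f. \<Sum>m\<in>Poly_Mapping.keys (poly.coeff f k).
          monom (Poly_Mapping.single m (Poly_Mapping.lookup (poly.coeff f k) m)) k) \<in> generate_ring ?R H"
        by (intro sum monom) auto
      then show "f \<in> generate_ring ?R H" by (simp only: poly_sum_monomials)
    qed
  qed
qed

section \<open>The fibre as a ring of monomials\<close>

definition total_degree :: "'v set \<Rightarrow> ('v \<Rightarrow>\<^sub>0 nat) \<Rightarrow> nat" where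
  "total_degree V m = (\<Sum>v\<in>V. Poly_Mapping.lookup m v)"

lemma total_degree_add: "total_degree V (m + m') = total_degree V m + total_degree V m'"
  by (simp add: total_degree_def lookup_add sum.distrib)

lemma total_degree_eq_0_iff:
  assumes "finite V" "Poly_Mapping.keys m \<subseteq> V"
  shows "total_degree V m = 0 \<longleftrightarrow> m = 0"
proof
  assume "total_degree V m = 0"
  then have "\<forall>v\<in>V. v \<notin> Poly_Mapping.keys m"
    using assms(1) by (simp add: total_degree_def in_keys_iff)
  then have "Poly_Mapping.keys m = {}" using assms(2) by blast
  then show "m = 0" by simp
qed (simp add: total_degree_def)

lemma total_degree_cover_products:
  assumes "finite V" "\<And>C. C \<in> \<C> \<Longrightarrow> C \<subseteq> V" "\<And>C. C \<in> \<C> \<Longrightarrow> card C = n"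
    and "(k, m) \<in> cover_products \<C>"
  shows "total_degree V m = k * n"
  using assms(4)
proof (induction rule: cover_products.induct)
  case zero
  then show ?case by (simp add: total_degree_def)
next
  case (Suc k m C)
  have C: "C \<subseteq> V" "finite C" "card C = n" using assms(1-3) Suc(2) finite_subset by blast+
  have "total_degree V (indicator_monomial C) = (\<Sum>v\<in>V. if v \<in> C then 1 else 0)"
    using C(2) by (simp add: total_degree_def lookup_indicator_monomial)
  also have "\<dots> = n"
    using C assms(1) by (simp add: sum.If_cases Int_absorb1)
  finally show ?case using Suc(3) by (simp add: total_degree_add)
qed

text \<open>
  On the algebra, all monomials of the coefficient of \<open>t\<^sup>k\<close> have degree at least \<open>k n\<close>. Those of degree
  exactly \<open>k n\<close> are kept, with exponents renamed by \<open>\<beta>\<close>.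
\<close>

definition lowest_part ::
    "'v set \<Rightarrow> nat \<Rightarrow> (nat \<Rightarrow> ('v \<Rightarrow>\<^sub>0 nat) \<Rightarrow> ('w \<Rightarrow>\<^sub>0 nat)) \<Rightarrow> ('v, 'k::field) mpoly poly \<Rightarrow> ('w, 'k) mpoly" where
  "lowest_part V n \<beta> = poly_linear_extension
     (\<lambda>k m. if total_degree V m = k * n then Poly_Mapping.single (\<beta> k m) 1 else 0)"

text \<open>
  The degree of a monomial \<open>m t\<^sup>k\<close> of the algebra exceeds \<open>k n\<close> by the degree of the factor from \<open>S\<close>. If the excess is
  positive, a variable can be split off, so the monomial lies in \<open>\<mm> A(G)\<close>; if it is zero, the monomial
  is a product of \<open>u\<^sub>C t\<close>, and distinct ones have distinct images because \<open>\<beta>\<close> is injective there. So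
  the kernel of \<open>lowest_part\<close> is \<open>\<mm> A(G)\<close>. It is multiplicative since excesses add up.
\<close>

theorem fibre_as_monomial_algebra:
  fixes V :: "'v set" and E :: "'v set set" and n :: nat and \<beta> :: "nat \<Rightarrow> ('v \<Rightarrow>\<^sub>0 nat) \<Rightarrow> ('w \<Rightarrow>\<^sub>0 nat)"
  defines "A \<equiv> vertex_cover_algebra V E :: ('v, 'k::field) mpoly poly ring"
    and "\<C> \<equiv> minimal_vertex_covers V E"
  defines "B \<equiv> lowest_part V n \<beta> ` carrier A"
  assumes fin: "finite V"
    and card: "\<And>C. C \<in> \<C> \<Longrightarrow> card C = n"
    and \<beta>_0: "\<beta> 0 0 = 0"
    and \<beta>_add: "\<And>k k' m m'. \<beta> (k + k') (m + m') = \<beta> k m + \<beta> k' m'"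
    and \<beta>_keys: "\<And>k m. Poly_Mapping.keys (\<beta> k m) \<subseteq> W"
    and \<beta>_inj: "\<And>k m k' m'. (k, m) \<in> cover_products \<C> \<Longrightarrow> (k', m') \<in> cover_products \<C> \<Longrightarrow>
      \<beta> k m = \<beta> k' m' \<Longrightarrow> k = k' \<and> m = m'"
  shows "krull_dim (vertex_cover_fibre V E :: ('v, 'k) mpoly poly set ring) =
      krull_dim ((mpoly_ring W)\<lparr>carrier := B\<rparr>)"
    and "subring B (mpoly_ring W)"
    and "Poly_Mapping.single 0 c \<in> B"
    and "C \<in> \<C> \<Longrightarrow> Poly_Mapping.single (\<beta> 1 (indicator_monomial C)) 1 \<in> B"
proof -
  define \<phi> :: "('v, 'k) mpoly poly \<Rightarrow> ('w, 'k) mpoly" where "\<phi> = lowest_part V n \<beta>"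
  define h :: "nat \<Rightarrow> ('v \<Rightarrow>\<^sub>0 nat) \<Rightarrow> ('w, 'k) mpoly"
    where "h k m = (if total_degree V m = k * n then Poly_Mapping.single (\<beta> k m) 1 else 0)" for k m
  have \<phi>: "\<phi> = poly_linear_extension h" by (simp add: \<phi>_def lowest_part_def h_def[abs_def])
  let ?M = "algebra_monomials V \<C>"
  let ?T = "mpoly_ring W :: ('w, 'k) mpoly ring"
  have carr: "carrier A = {f. \<forall>k. \<forall>m\<in>Poly_Mapping.keys (poly.coeff f k). (k, m) \<in> ?M}"
    unfolding A_def \<C>_def by (rule carrier_vertex_cover_algebra[OF fin])
  have covV: "C \<subseteq> V" if "C \<in> \<C>" for C
    using that minimal_vertex_coversD(2) by (simp add: \<C>_def)
  have A_simps [simp]: "f \<otimes>\<^bsub>A\<^esub> g = f * g" "f \<oplus>\<^bsub>A\<^esub> g = f + g" "\<one>\<^bsub>A\<^esub> = 1" "\<zero>\<^bsub>A\<^esub> = 0" for f g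
    by (simp_all add: A_def)
  have cringA: "cring A" unfolding A_def by (rule cring_vertex_cover_algebra[OF fin])
  interpret A: cring A by (rule cringA)
  interpret T: cring ?T by (rule cring_mpoly_ring)
  have deg_prod: "total_degree V m = k * n" if "(k, m) \<in> cover_products \<C>" for k m
    using total_degree_cover_products[OF fin covV card that] .
  have deg_ge: "k * n \<le> total_degree V m" if "(k, m) \<in> ?M" for k m
    using that by (elim algebra_monomialsE) (simp add: total_degree_add deg_prod)
  have tight: "(k, m) \<in> cover_products \<C>" if "(k, m) \<in> ?M" "total_degree V m = k * n" for k m
  proof -
    obtain w a where w: "m = w + a" "Poly_Mapping.keys w \<subseteq> V" "(k, a) \<in> cover_products \<C>"
      using \<open>(k, m) \<in> ?M\<close> by (rule algebra_monomialsE)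
    then have "total_degree V w = 0" using \<open>total_degree V m = k * n\<close> by (simp add: total_degree_add deg_prod)
    then show ?thesis using w total_degree_eq_0_iff[OF fin w(2)] by simp
  qed
  have h_mult: "h (k + k') (m + m') = h k m * h k' m'" if "(k, m) \<in> ?M" "(k', m') \<in> ?M" for k k' m m'
  proof -
    have "total_degree V (m + m') = (k + k') * n \<longleftrightarrow> total_degree V m = k * n \<and> total_degree V m' = k' * n"
      using deg_ge[OF that(1)] deg_ge[OF that(2)] by (auto simp: total_degree_add algebra_simps)
    then show ?thesis by (auto simp: h_def \<beta>_add mult_single)
  qed
  have \<phi>_const: "\<phi> [:s:] = linear_extension (h 0) s" for s
    using poly_linear_extension_monom[of h s 0] by (simp add: \<phi> monom_0)
  have h_0: "h 0 0 = 1" by (simp add: h_def total_degree_def \<beta>_0)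
  have \<phi>_carr: "\<phi> f \<in> carrier ?T" for f
    unfolding \<phi> poly_linear_extension_def linear_extension_def
  proof (intro mpoly_ring_sum_closed mpoly_ring_mult_closed)
    show "h k m \<in> carrier ?T" for k m using \<beta>_keys by (auto simp: h_def mpoly_ring_carrier)
  qed (simp add: mpoly_ring_carrier)
  have hom: "\<phi> \<in> ring_hom A ?T"
  proof (rule ring_hom_memI)
    fix f g assume "f \<in> carrier A" "g \<in> carrier A"
    then have "poly_linear_extension h (f * g) = poly_linear_extension h f * poly_linear_extension h g"
      by (intro poly_linear_extension_times h_mult) (simp_all add: carr)
    then show "\<phi> (f \<otimes>\<^bsub>A\<^esub> g) = \<phi> f \<otimes>\<^bsub>?T\<^esub> \<phi> g" by (simp add: \<phi>)
  next
    show "\<phi> \<one>\<^bsub>A\<^esub> = \<one>\<^bsub>?T\<^esub>"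
      using \<phi>_const[of 1] linear_extension_single[of "h 0" 0 1] h_0 by (simp add: one_pCons)
  qed (simp_all add: \<phi>_carr, simp add: \<phi> poly_linear_extension_add)
  interpret H: ring_hom_ring A ?T \<phi>
    by (rule ring_hom_ringI2) (use hom A.ring_axioms T.ring_axioms in auto)
  have M_w: "(0, w) \<in> ?M" if "Poly_Mapping.keys w \<subseteq> V" for w
    using algebra_monomialsI[OF that cover_products.zero] by simp
  have constA: "[:s:] \<in> carrier A" if "s \<in> carrier (mpoly_ring V)" for s
    using that M_w by (auto simp: carr mpoly_ring_carrier coeff_pCons split: nat.splits)
  have monomA: "monom (Poly_Mapping.single m c) k \<in> carrier A" if "(k, m) \<in> ?M" for k m c
    using that by (auto simp: carr coeff_monom)
  show "subring B (mpoly_ring W)"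
    unfolding B_def \<phi>_def[symmetric] using A.carrier_is_subring by (rule H.img_is_subring)
  show "Poly_Mapping.single 0 c \<in> B"
  proof -
    have "[:Poly_Mapping.single 0 c:] \<in> carrier A" by (rule constA) (simp add: mpoly_ring_carrier)
    moreover have "\<phi> [:Poly_Mapping.single 0 c:] = Poly_Mapping.single 0 c" by (simp add: \<phi>_const h_0)
    ultimately show ?thesis unfolding B_def \<phi>_def[symmetric] by (metis imageI)
  qed
  show "Poly_Mapping.single (\<beta> 1 (indicator_monomial C)) 1 \<in> B" if "C \<in> \<C>"
  proof -
    have prod: "(1, indicator_monomial C) \<in> cover_products \<C>" using that by (rule cover_products_single)
    have "\<phi> (monom (Poly_Mapping.single (indicator_monomial C) 1) 1) = Poly_Mapping.single (\<beta> 1 (indicator_monomial C)) 1"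
      using deg_prod[OF prod] by (simp add: \<phi> h_def)
    then show ?thesis unfolding B_def \<phi>_def[symmetric]
      using monomA[OF cover_products_subset_algebra_monomials[OF prod]] by (metis imageI)
  qed
  let ?J = "Idl\<^bsub>A\<^esub> ((\<lambda>s. [:s:]) ` graded_maximal_ideal V)"
  interpret S: cring "mpoly_ring V :: ('v, 'k) mpoly ring" by (rule cring_mpoly_ring)
  have vars: "mvar ` V \<subseteq> carrier (mpoly_ring V :: ('v, 'k) mpoly ring)"
    by (auto simp: mvar_def mpoly_ring_carrier)
  \<comment> \<open>the constant terms of the elements of \<open>\<mm>\<close> vanish, so their lowest parts do\<close>
  have no_const: "graded_maximal_ideal V \<subseteq> {s \<in> carrier (mpoly_ring V :: ('v, 'k) mpoly ring). 0 \<notin> Poly_Mapping.keys s}"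
    (is "_ \<subseteq> ?I")
    unfolding graded_maximal_ideal_def
  proof (rule S.genideal_minimal)
    have "Poly_Mapping.single v (1 :: nat) \<noteq> 0" for v :: 'v
      by (metis lookup_single_eq lookup_zero zero_neq_one)
    then show "mvar ` V \<subseteq> ?I" using vars by (auto simp: mvar_def)
    have mult0: "0 \<notin> Poly_Mapping.keys (p * q)" if "0 \<notin> Poly_Mapping.keys p" for p q :: "('v, 'k) mpoly"
    proof
      assume "0 \<in> Poly_Mapping.keys (p * q)"
      then obtain a b where ab: "a \<in> Poly_Mapping.keys p" "b \<in> Poly_Mapping.keys q" "0 = a + b"
        by (rule keys_times_subset)
      then have "Poly_Mapping.keys a = {}" using keys_plus_nat[of a b] by simp
      then show False using ab(1) that by simp
    qed
    show "ideal ?I (mpoly_ring V)"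
    proof (rule idealI)
      show "subgroup ?I (add_monoid (mpoly_ring V))"
      proof (rule S.add.subgroupI)
        show "?I \<noteq> {}" by (auto simp: mpoly_ring_carrier intro: exI[of _ 0])
        fix p q assume p: "p \<in> ?I" and q: "q \<in> ?I"
        have "\<ominus>\<^bsub>mpoly_ring V\<^esub> p = - p"
          by (rule S.minus_equality) (use p in \<open>auto simp: mpoly_ring_carrier\<close>)
        then show "\<ominus>\<^bsub>mpoly_ring V\<^esub> p \<in> ?I" using p by (simp add: mpoly_ring_carrier)
        show "p \<oplus>\<^bsub>mpoly_ring V\<^esub> q \<in> ?I"
          using p q keys_add[of p q] by (auto simp: mpoly_ring_add_closed)
      qed auto
    next
      fix a x assume a: "a \<in> ?I" "x \<in> carrier (mpoly_ring V :: ('v, 'k) mpoly ring)"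
      then show "a \<otimes>\<^bsub>mpoly_ring V\<^esub> x \<in> ?I" using mult0 by (simp add: mpoly_ring_mult_closed)
      then show "x \<otimes>\<^bsub>mpoly_ring V\<^esub> a \<in> ?I" using \<open>a \<otimes>\<^bsub>mpoly_ring V\<^esub> x \<in> ?I\<close> by (simp add: mult.commute)
    qed (rule S.ring_axioms)
  qed
  have gens: "(\<lambda>s. [:s:]) ` graded_maximal_ideal V \<subseteq> carrier A"
    using no_const constA by auto
  have "?J = a_kernel A ?T \<phi>"
  proof (rule equalityI)
    show "?J \<subseteq> a_kernel A ?T \<phi>"
    proof (rule A.genideal_minimal[OF H.kernel_is_ideal], clarify)
      fix s :: "('v, 'k) mpoly" assume "s \<in> graded_maximal_ideal V"
      then have s: "s \<in> carrier (mpoly_ring V)" "0 \<notin> Poly_Mapping.keys s" using no_const by auto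
      have "h 0 m = 0" if "m \<in> Poly_Mapping.keys s" for m
      proof -
        have "Poly_Mapping.keys m \<subseteq> V" "m \<noteq> 0" using s that by (auto simp: mpoly_ring_carrier)
        then show ?thesis using total_degree_eq_0_iff[OF fin, of m] by (simp add: h_def)
      qed
      then have "\<phi> [:s:] = 0" unfolding \<phi>_const linear_extension_def by (intro sum.neutral ballI) simp
      then show "[:s:] \<in> a_kernel A ?T \<phi>" using constA[OF s(1)] unfolding a_kernel_def' by simp
    qed
  next
    interpret J: ideal ?J A using gens by (rule A.genideal_ideal)
    show "a_kernel A ?T \<phi> \<subseteq> ?J"
    proof
      fix f assume "f \<in> a_kernel A ?T \<phi>"
      then have f: "f \<in> carrier A" "\<phi> f = 0" unfolding a_kernel_def' by simp_all
      have mon: "monom (Poly_Mapping.single m c) k \<in> ?J" if km: "m \<in> Poly_Mapping.keys (poly.coeff f k)" for k m c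
      proof -
        have M: "(k, m) \<in> ?M" using f(1) km by (simp add: carr)
        have "total_degree V m \<noteq> k * n"
        proof
          assume deg: "total_degree V m = k * n"
          have "k \<le> degree f" using km by (intro le_degree) auto
          \<comment> \<open>no other monomial of \<open>f\<close> contributes to the coefficient of the image of \<open>m t\<^sup>k\<close>\<close>
          have "Poly_Mapping.lookup (\<phi> f) (\<beta> k m) = (\<Sum>k'\<le>degree f. \<Sum>m'\<in>Poly_Mapping.keys (poly.coeff f k').
              Poly_Mapping.lookup (Poly_Mapping.single 0 (Poly_Mapping.lookup (poly.coeff f k') m') * h k' m') (\<beta> k m))"
            by (simp add: \<phi> poly_linear_extension_def linear_extension_def lookup_sum)
          also have "\<dots> = (\<Sum>k'\<le>degree f. \<Sum>m'\<in>Poly_Mapping.keys (poly.coeff f k').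
              if k' = k \<and> m' = m then Poly_Mapping.lookup (poly.coeff f k) m else 0)"
          proof (intro sum.cong refl)
            fix k' m' assume "m' \<in> Poly_Mapping.keys (poly.coeff f k')"
            then have M': "(k', m') \<in> ?M" using f(1) by (simp add: carr)
            have "k' = k \<and> m' = m" if "total_degree V m' = k' * n" "\<beta> k' m' = \<beta> k m"
              using \<beta>_inj[OF tight[OF M' that(1)] tight[OF M deg] that(2)] .
            then show "Poly_Mapping.lookup (Poly_Mapping.single 0 (Poly_Mapping.lookup (poly.coeff f k') m') * h k' m') (\<beta> k m) =
              (if k' = k \<and> m' = m then Poly_Mapping.lookup (poly.coeff f k) m else 0)"
              using deg by (auto simp: h_def mult_single lookup_single when_def)
          qed
          also have "\<dots> = (\<Sum>k'\<le>degree f. if k' = k then Poly_Mapping.lookup (poly.coeff f k) m else 0)"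
            by (intro sum.cong refl) (use km in \<open>auto\<close>)
          also have "\<dots> = Poly_Mapping.lookup (poly.coeff f k) m" using \<open>k \<le> degree f\<close> by simp
          finally show False using f(2) km by (simp add: in_keys_iff)
        qed
        obtain w a where w: "m = w + a" "Poly_Mapping.keys w \<subseteq> V" "(k, a) \<in> cover_products \<C>"
          using M by (rule algebra_monomialsE)
        have "w \<noteq> 0" using w deg_prod[OF w(3)] \<open>total_degree V m \<noteq> k * n\<close> by auto
        then obtain v where v: "v \<in> Poly_Mapping.keys w" using keys_eq_empty by blast
        \<comment> \<open>split off a variable \<open>v\<close> of the factor \<open>w\<close> from \<open>S\<close>; the rest still belongs to the algebra\<close>
        define w' where "w' = w - Poly_Mapping.single v 1"
        have w': "w = Poly_Mapping.single v 1 + w'"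
          using v by (intro poly_mapping_eqI) (auto simp: w'_def lookup_add lookup_minus lookup_single when_def in_keys_iff)
        have "Poly_Mapping.keys w' \<subseteq> V" using w(2) by (simp add: w' keys_plus_nat)
        then have "(k, w' + a) \<in> ?M" using w(3) by (rule algebra_monomialsI)
        then have "monom (Poly_Mapping.single (w' + a) c) k \<in> carrier A" by (rule monomA)
        moreover have "[:mvar v:] \<in> ?J"
        proof -
          have "mvar v \<in> mvar ` V" using v w(2) by blast
          then have "mvar v \<in> (graded_maximal_ideal V :: ('v, 'k) mpoly set)"
            unfolding graded_maximal_ideal_def by (rule subsetD[OF S.genideal_self[OF vars]])
          then have "[:mvar v:] \<in> (\<lambda>s. [:s:]) ` (graded_maximal_ideal V :: ('v, 'k) mpoly set)"
            by (rule imageI)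
          then show ?thesis by (rule subsetD[OF A.genideal_self[OF gens]])
        qed
        ultimately have "[:mvar v:] \<otimes>\<^bsub>A\<^esub> monom (Poly_Mapping.single (w' + a) c) k \<in> ?J"
          by (intro J.I_r_closed)
        then show ?thesis by (simp add: w w' mvar_def smult_monom mult_single add.assoc)
      qed
      have sumJ: "(\<Sum>i\<in>I. p i) \<in> ?J" if "\<And>i. i \<in> I \<Longrightarrow> p i \<in> ?J" for I :: "'i set" and p
        using that J.zero_closed J.a_closed by (induction I rule: infinite_finite_induct) auto
      have "(\<Sum>k\<le>degree f. \<Sum>m\<in>Poly_Mapping.keys (poly.coeff f k).
          monom (Poly_Mapping.single m (Poly_Mapping.lookup (poly.coeff f k) m)) k) \<in> ?J"
        by (intro sumJ mon)
      then show "f \<in> ?J" by (simp only: poly_sum_monomials)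
    qed
  qed
  then have "vertex_cover_fibre V E = A Quot a_kernel A ?T \<phi>"
    by (simp add: vertex_cover_fibre_def A_def)
  then show "krull_dim (vertex_cover_fibre V E :: ('v, 'k) mpoly poly set ring) =
      krull_dim ((mpoly_ring W)\<lparr>carrier := B\<rparr>)"
    using krull_dim_Quot_kernel[OF cringA cring_mpoly_ring hom] by (simp add: B_def \<phi>_def)
qed

section \<open>Chains of maximal size in lattices of sets\<close>

lemma finite_chain_enumeration:
  assumes "subset.chain L Ch" "card Ch = Suc r"
  shows "\<exists>c :: nat \<Rightarrow> 'a set. Ch = c ` {..r} \<and> (\<forall>i j. i < j \<longrightarrow> j \<le> r \<longrightarrow> c i \<subset> c j)"
  using assms
proof (induction r arbitrary: Ch)
  case 0
  then obtain A where "Ch = {A}" by (auto simp: card_Suc_eq)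
  then show ?case by (intro exI[of _ "\<lambda>_. A"]) auto
next
  case (Suc r)
  have fin: "finite Ch" "Ch \<noteq> {}" using Suc.prems(2) by (auto intro: card_ge_0_finite)
  have chain: "A \<subseteq> B \<or> B \<subseteq> A" if "A \<in> Ch" "B \<in> Ch" for A B
    using Suc.prems(1) that unfolding subset_chain_def by blast
  obtain U where U: "U \<in> Ch" "\<And>A. A \<in> Ch \<Longrightarrow> U \<subseteq> A \<Longrightarrow> A = U"
    using finite_has_maximal[OF fin] by metis
  have top: "A \<subseteq> U" if "A \<in> Ch" for A using chain[OF that U(1)] U(2)[OF that] by blast
  have "subset.chain L (Ch - {U})" using Suc.prems(1) unfolding subset_chain_def by blast
  moreover have "card (Ch - {U}) = Suc r" using Suc.prems(2) U(1) fin(1) by simp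
  ultimately obtain c where c: "Ch - {U} = c ` {..r}" "\<And>i j. i < j \<Longrightarrow> j \<le> r \<Longrightarrow> c i \<subset> c j"
    using Suc.IH by metis
  define d where "d = c(Suc r := U)"
  have less: "c i \<subset> U" if "i \<le> r" for i
  proof -
    have "c i \<in> Ch - {U}" using c(1) that by blast
    then show ?thesis using top by blast
  qed
  have "Ch = insert U (Ch - {U})" using U(1) by blast
  also have "\<dots> = insert U (c ` {..r})" by (simp only: c(1))
  also have "\<dots> = d ` {..Suc r}" by (force simp: d_def atMost_Suc)
  finally have "Ch = d ` {..Suc r}" .
  moreover have "d i \<subset> d j" if "i < j" "j \<le> Suc r" for i j
    using that c(2)[of i j] less[of i] by (auto simp: d_def le_Suc_eq)
  ultimately show ?case by blast
qed

text \<open>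
  A member comparable with all terms of a chain could be inserted into it, which is impossible if the
  chain has maximal size.
\<close>

lemma maximum_chain:
  assumes "finite L" "L \<noteq> {}"
  obtains c :: "nat \<Rightarrow> 'a set" where
    "\<And>i. i \<le> lattice_rank L \<Longrightarrow> c i \<in> L"
    "\<And>i j. i < j \<Longrightarrow> j \<le> lattice_rank L \<Longrightarrow> c i \<subset> c j"
    "\<And>A. A \<in> L \<Longrightarrow> (\<And>i. i \<le> lattice_rank L \<Longrightarrow> A \<subseteq> c i \<or> c i \<subseteq> A) \<Longrightarrow> \<exists>i\<le>lattice_rank L. A = c i"
proof -
  define N where "N = {card Ch | Ch. subset.chain L Ch}"
  have "N \<subseteq> {..card L}"
    using assms(1) by (auto simp: N_def subset_chain_def intro: card_mono)
  then have finN: "finite N" using finite_subset by blast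
  obtain A where "A \<in> L" using assms(2) by blast
  then have "subset.chain L {A}" by (simp add: subset_chain_def)
  then have "card {A} \<in> N" unfolding N_def by blast
  then have "1 \<le> Max N" using finN Max_ge by fastforce
  then have MaxN: "Max N = Suc (lattice_rank L)" by (simp add: lattice_rank_def N_def)
  have "N \<noteq> {}" using \<open>card {A} \<in> N\<close> by blast
  then have "Max N \<in> N" by (rule Max_in[OF finN])
  then obtain Ch where Ch: "subset.chain L Ch" "card Ch = Suc (lattice_rank L)"
    unfolding MaxN by (auto simp: N_def)
  have finCh: "finite Ch" using Ch(2) by (auto intro: card_ge_0_finite)
  obtain c where c: "Ch = c ` {..lattice_rank L}" "\<And>i j. i < j \<Longrightarrow> j \<le> lattice_rank L \<Longrightarrow> c i \<subset> c j"
    using finite_chain_enumeration[OF Ch] by metis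
  show thesis
  proof (rule that[of c])
    show "c i \<in> L" if "i \<le> lattice_rank L" for i
      using Ch(1) that unfolding c(1) subset_chain_def by blast
    show "c i \<subset> c j" if "i < j" "j \<le> lattice_rank L" for i j using that by (rule c(2))
    fix A assume A: "A \<in> L" "\<And>i. i \<le> lattice_rank L \<Longrightarrow> A \<subseteq> c i \<or> c i \<subseteq> A"
    show "\<exists>i\<le>lattice_rank L. A = c i"
    proof (rule ccontr)
      assume "\<not> ?thesis"
      then have "A \<notin> Ch" using c(1) by blast
      then have "card (insert A Ch) = Suc (Suc (lattice_rank L))" using finCh Ch(2) by simp
      moreover have "subset.chain L (insert A Ch)"
        using Ch(1) A unfolding c(1) subset_chain_def by blast
      ultimately have "Suc (Suc (lattice_rank L)) \<in> N" unfolding N_def by (metis (mono_tags, lifting) CollectI)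
      then have "Suc (Suc (lattice_rank L)) \<le> Max N" by (rule Max_ge[OF finN])
      then show False using MaxN by simp
    qed
  qed
qed

text \<open>
  The set \<open>B = (A \<union> c i) \<inter> c (Suc i)\<close> lies between two neighbours of the chain, so it is one of
  them. Hence \<open>A\<close> contains all or none of the elements that are new in \<open>c (Suc i)\<close>.
\<close>

lemma sublattice_constant_on_chain_steps:
  assumes chain: "\<And>i. i \<le> r \<Longrightarrow> c i \<in> L" "\<And>i j. i < j \<Longrightarrow> j \<le> r \<Longrightarrow> c i \<subset> c j"
    and maximal: "\<And>A. A \<in> L \<Longrightarrow> (\<And>i. i \<le> r \<Longrightarrow> A \<subseteq> c i \<or> c i \<subseteq> A) \<Longrightarrow> \<exists>i\<le>r. A = c i"
    and lattice: "\<And>A B. A \<in> L \<Longrightarrow> B \<in> L \<Longrightarrow> A \<inter> B \<in> L" "\<And>A B. A \<in> L \<Longrightarrow> B \<in> L \<Longrightarrow> A \<union> B \<in> L"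
    and "i < r" "v \<in> c (Suc i) - c i" "w \<in> c (Suc i) - c i" "A \<in> L"
  shows "v \<in> A \<longleftrightarrow> w \<in> A"
proof -
  define B where "B = (A \<union> c i) \<inter> c (Suc i)"
  have mono: "c j \<subseteq> c k" if "j \<le> k" "k \<le> r" for j k
    using chain(2)[of j k] that by (cases "j = k") auto
  have "c i \<subseteq> c (Suc i)" using mono \<open>i < r\<close> by simp
  then have between: "c i \<subseteq> B" "B \<subseteq> c (Suc i)" by (auto simp: B_def)
  have "B \<in> L" unfolding B_def using assms(6,9) by (intro lattice chain(1)) auto
  moreover have "B \<subseteq> c j \<or> c j \<subseteq> B" if "j \<le> r" for j
  proof (cases "j \<le> i")
    case True
    then show ?thesis using mono[of j i] \<open>i < r\<close> between by auto
  next
    case False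
    then show ?thesis using mono[of "Suc i" j] that between by auto
  qed
  ultimately obtain j where j: "j \<le> r" "B = c j" using maximal by blast
  have "B = c i \<or> B = c (Suc i)"
  proof (cases "j \<le> i")
    case True
    then show ?thesis using mono[of j i] \<open>i < r\<close> between j by auto
  next
    case False
    then show ?thesis using mono[of "Suc i" j] between j by auto
  qed
  then show ?thesis using assms(7,8) unfolding B_def by blast
qed

section \<open>Unmixed bipartite graphs with a perfect matching\<close>

locale unmixed_matched_bipartite =
  fixes V :: "'v set" and E :: "'v set set" and x y :: "nat \<Rightarrow> 'v" and n :: nat
  assumes simple: "simple_graph V E"
    and inj_x: "inj_on x {1..n}" and inj_y: "inj_on y {1..n}"
    and bipartition: "bipartition V E (x ` {1..n}) (y ` {1..n})"
    and matching: "\<And>i. i \<in> {1..n} \<Longrightarrow> {x i, y i} \<in> E"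
    and unmixed: "unmixed V E"
begin

abbreviation "X \<equiv> x ` {1..n}"
abbreviation "Y \<equiv> y ` {1..n}"

lemma finite_V: "finite V" and V_eq: "V = X \<union> Y" and disjoint: "X \<inter> Y = {}"
  using simple bipartition by (auto simp: simple_graph_def bipartition_def)

lemma edgeE:
  assumes "e \<in> E"
  obtains i j where "i \<in> {1..n}" "j \<in> {1..n}" "e = {x i, y j}"
proof -
  have "card (e \<inter> X) = 1" "card (e \<inter> Y) = 1" and "e \<subseteq> V"
    using assms simple bipartition by (auto simp: simple_graph_def bipartition_def)
  from this(1,2) obtain u w where uw: "e \<inter> X = {u}" "e \<inter> Y = {w}" by (metis card_1_singletonE)
  then have "u \<in> X" "w \<in> Y" by auto
  moreover have "e = {u, w}" using uw \<open>e \<subseteq> V\<close> V_eq by blast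
  ultimately show thesis using that by auto
qed

lemma vertex_coverI:
  assumes "C \<subseteq> V" and "\<And>u w. u \<in> X \<Longrightarrow> w \<in> Y \<Longrightarrow> {u, w} \<in> E \<Longrightarrow> u \<in> C \<or> w \<in> C"
  shows "vertex_cover V E C"
  unfolding vertex_cover_def
proof (intro conjI ballI)
  fix e assume "e \<in> E"
  then show "e \<inter> C \<noteq> {}" by (rule edgeE) (use \<open>e \<in> E\<close> assms(2) in auto)
qed (rule assms(1))

lemma vertex_coverD: "vertex_cover V E C \<Longrightarrow> {u, w} \<in> E \<Longrightarrow> u \<in> C \<or> w \<in> C"
  using bspec[of E "\<lambda>e. e \<inter> C \<noteq> {}" "{u, w}"] by (auto simp: vertex_cover_def)

text \<open>
  Each matching edge is covered only once, so no vertex can be dropped.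
\<close>

lemma minimal_vertex_coverI:
  assumes cover: "vertex_cover V E C" and half: "\<And>i. i \<in> {1..n} \<Longrightarrow> \<not> (x i \<in> C \<and> y i \<in> C)"
  shows "C \<in> minimal_vertex_covers V E"
proof -
  have "\<not> vertex_cover V E D" if "D \<subset> C" for D
  proof
    assume D: "vertex_cover V E D"
    obtain v where v: "v \<in> C" "v \<notin> D" using \<open>D \<subset> C\<close> by blast
    then have "v \<in> X \<union> Y" using cover V_eq by (auto simp: vertex_cover_def)
    then obtain i where i: "i \<in> {1..n}" "v = x i \<or> v = y i" by blast
    have "x i \<in> D \<or> y i \<in> D" using D matching[OF i(1)] by (rule vertex_coverD)
    then show False using half[OF i(1)] v i(2) that by auto
  qed
  then show ?thesis using cover by (simp add: minimal_vertex_covers_def)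
qed

lemma sides: "i \<in> {1..n} \<Longrightarrow> x i \<notin> Y" "i \<in> {1..n} \<Longrightarrow> y i \<notin> X"
  using disjoint by blast+

lemma sides_minimal: "X \<in> minimal_vertex_covers V E" "Y \<in> minimal_vertex_covers V E"
proof -
  have "vertex_cover V E X" by (rule vertex_coverI) (use V_eq in blast)+
  moreover have "vertex_cover V E Y" by (rule vertex_coverI) (use V_eq in blast)+
  ultimately show "X \<in> minimal_vertex_covers V E" "Y \<in> minimal_vertex_covers V E"
    using sides by (blast intro: minimal_vertex_coverI)+
qed

lemma card_minimal_vertex_cover: "C \<in> minimal_vertex_covers V E \<Longrightarrow> card C = n"
  using unmixed sides_minimal(1) card_image[OF inj_x] unfolding unmixed_def by fastforce

text \<open>
  By unmixedness, \<open>C\<close> has as many elements as the side \<open>X\<close>, that is, as there are matching edges. It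
  meets each of these disjoint edges, so it meets each exactly once.
\<close>

lemma minimal_vertex_cover_iff:
  assumes C: "C \<in> minimal_vertex_covers V E" and i: "i \<in> {1..n}"
  shows "x i \<in> C \<longleftrightarrow> y i \<notin> C"
proof -
  define I J where "I = {i \<in> {1..n}. x i \<in> C}" and "J = {i \<in> {1..n}. y i \<in> C}"
  have cover: "vertex_cover V E C" using C by (rule minimal_vertex_coversD)
  have union: "I \<union> J = {1..n}"
    using vertex_coverD[OF cover matching] by (fastforce simp: I_def J_def)
  have "C = x ` I \<union> y ` J" using minimal_vertex_coversD(2)[OF C] V_eq unfolding I_def J_def by blast
  moreover have "x ` I \<inter> y ` J = {}" using disjoint unfolding I_def J_def by blast
  moreover have fin: "finite I" "finite J" by (simp_all add: I_def J_def)
  ultimately have "card C = card (x ` I) + card (y ` J)" by (simp add: card_Un_disjoint)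
  also have "\<dots> = card I + card J"
    using inj_on_subset[OF inj_x, of I] inj_on_subset[OF inj_y, of J] union by (metis card_image Un_upper1 Un_upper2)
  also have "\<dots> = n + card (I \<inter> J)"
    using card_Un_Int[OF fin] union by simp
  finally have "card (I \<inter> J) = 0" using card_minimal_vertex_cover[OF C] by simp
  then have "I \<inter> J = {}" using fin by simp
  then show ?thesis using union i unfolding I_def J_def by blast
qed

abbreviation "L \<equiv> cover_lattice V E X"

lemma cover_lattice_eq: "L = (\<lambda>C. C \<inter> X) ` minimal_vertex_covers V E"
  by (auto simp: cover_lattice_def)

lemma cover_lattice_subset: "A \<in> L \<Longrightarrow> A \<subseteq> X"
  by (auto simp: cover_lattice_def)

lemma finite_cover_lattice: "finite L"
  by (rule finite_subset[of _ "Pow X"]) (use cover_lattice_subset in auto)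

lemma cover_lattice_bounds: "{} \<in> L" "X \<in> L"
proof -
  have "{} = Y \<inter> X" "X = X \<inter> X" using disjoint by blast+
  then show "{} \<in> L" "X \<in> L" unfolding cover_lattice_eq using sides_minimal by (metis imageI)+
qed

text \<open>
  Intersecting on one side and uniting on the other keeps a cover: if \<open>u\<close> is missing from \<open>C\<close> or
  from \<open>D\<close>, that cover contains the neighbours of \<open>u\<close>. These covers realise the meet and the join of
  the lattice.
\<close>

lemma mixed_cover_minimal:
  assumes C: "C \<in> minimal_vertex_covers V E" and D: "D \<in> minimal_vertex_covers V E"
  shows "(C \<inter> D \<inter> X) \<union> ((C \<union> D) \<inter> Y) \<in> minimal_vertex_covers V E" (is "?M \<in> _")
    and "((C \<union> D) \<inter> X) \<union> (C \<inter> D \<inter> Y) \<in> minimal_vertex_covers V E" (is "?J \<in> _")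
proof -
  note cov = vertex_coverD[OF minimal_vertex_coversD(1)[OF C]] vertex_coverD[OF minimal_vertex_coversD(1)[OF D]]
  have "vertex_cover V E ?M"
    by (rule vertex_coverI) (use cov V_eq in blast)+
  then show "?M \<in> minimal_vertex_covers V E"
    by (rule minimal_vertex_coverI) (use minimal_vertex_cover_iff[OF C] minimal_vertex_cover_iff[OF D] sides in blast)
  have "vertex_cover V E ?J"
    by (rule vertex_coverI) (use cov V_eq in blast)+
  then show "?J \<in> minimal_vertex_covers V E"
    by (rule minimal_vertex_coverI) (use minimal_vertex_cover_iff[OF C] minimal_vertex_cover_iff[OF D] sides in blast)
qed

lemma cover_lattice_closed:
  assumes "A \<in> L" "B \<in> L"
  shows "A \<inter> B \<in> L" "A \<union> B \<in> L"
proof -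
  obtain C D where CD: "C \<in> minimal_vertex_covers V E" "D \<in> minimal_vertex_covers V E"
    "A = C \<inter> X" "B = D \<inter> X"
    using assms unfolding cover_lattice_eq by blast
  have "A \<inter> B = ((C \<inter> D \<inter> X) \<union> ((C \<union> D) \<inter> Y)) \<inter> X" "A \<union> B = (((C \<union> D) \<inter> X) \<union> (C \<inter> D \<inter> Y)) \<inter> X"
    using CD disjoint by blast+
  then show "A \<inter> B \<in> L" "A \<union> B \<in> L"
    using mixed_cover_minimal[OF CD(1,2)] unfolding cover_lattice_eq by blast+
qed

text \<open>
  The variable \<open>0\<close> of the target ring records the power of \<open>t\<close>, and the variable \<open>Suc i\<close> the exponent
  of a representative of the vertices that enter the chain between \<open>c i\<close> and \<open>c (Suc i)\<close>.
\<close>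

theorem krull_dim_fibre:
  "krull_dim (vertex_cover_fibre V E :: ('v, 'k::field) mpoly poly set ring) = enat (lattice_rank L + 1)"
proof -
  define r where "r = lattice_rank L"
  obtain c where c: "\<And>i. i \<le> r \<Longrightarrow> c i \<in> L" "\<And>i j. i < j \<Longrightarrow> j \<le> r \<Longrightarrow> c i \<subset> c j"
    and maximal: "\<And>A. A \<in> L \<Longrightarrow> (\<And>i. i \<le> r \<Longrightarrow> A \<subseteq> c i \<or> c i \<subseteq> A) \<Longrightarrow> \<exists>i\<le>r. A = c i"
    unfolding r_def by (rule maximum_chain[of L]) (use finite_cover_lattice cover_lattice_bounds in auto)
  have mono: "c i \<subseteq> c j" if "i \<le> j" "j \<le> r" for i j
    using c(2)[of i j] that by (cases "i = j") auto
  have c_0: "c 0 = {}"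
  proof -
    obtain i where "i \<le> r" "{} = c i" using maximal[of "{}"] cover_lattice_bounds by auto
    then show ?thesis using mono[of 0 i] by auto
  qed
  have c_r: "c r = X"
  proof -
    obtain i where "i \<le> r" "X = c i"
      using maximal[of X] cover_lattice_bounds cover_lattice_subset[OF c(1)] by blast
    then show ?thesis using mono[of i r] cover_lattice_subset[OF c(1), of r] by auto
  qed
  let ?\<C> = "minimal_vertex_covers V E"
  have same_step: "v \<in> C \<longleftrightarrow> w \<in> C"
    if "C \<in> ?\<C>" "i < r" "v \<in> c (Suc i) - c i" "w \<in> c (Suc i) - c i" for C i v w
  proof -
    have "C \<inter> X \<in> L" unfolding cover_lattice_eq using that(1) by (rule imageI)
    have "v \<in> C \<inter> X \<longleftrightarrow> w \<in> C \<inter> X"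
    proof (rule sublattice_constant_on_chain_steps[where c = c and r = r and L = L and i = i])
      show "\<exists>i\<le>r. A = c i" if "A \<in> L" "\<And>i. i \<le> r \<Longrightarrow> A \<subseteq> c i \<or> c i \<subseteq> A" for A
        using that by (rule maximal)
    qed (fact c cover_lattice_closed \<open>i < r\<close> \<open>C \<inter> X \<in> L\<close> that)+
    moreover have "v \<in> X" "w \<in> X" using that cover_lattice_subset[OF c(1), of "Suc i"] by auto
    ultimately show ?thesis by blast
  qed
  define rep where "rep i = (SOME v. v \<in> c (Suc i) - c i)" for i
  have rep: "rep i \<in> c (Suc i) - c i" if "i < r" for i
  proof -
    have "c i \<subset> c (Suc i)" using c(2) that by simp
    then have "\<exists>v. v \<in> c (Suc i) - c i" by blast
    then show ?thesis unfolding rep_def by (rule someI_ex)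
  qed
  define \<beta> :: "nat \<Rightarrow> ('v \<Rightarrow>\<^sub>0 nat) \<Rightarrow> (nat \<Rightarrow>\<^sub>0 nat)" where
    "\<beta> k m = Poly_Mapping.single 0 k + (\<Sum>i<r. Poly_Mapping.single (Suc i) (Poly_Mapping.lookup m (rep i)))" for k m
  have \<beta>_lookup: "Poly_Mapping.lookup (\<beta> k m) j =
      (case j of 0 \<Rightarrow> k | Suc i \<Rightarrow> if i < r then Poly_Mapping.lookup m (rep i) else 0)" for k m j
    by (auto simp: \<beta>_def lookup_add lookup_sum lookup_single when_def split: nat.split)
  have fin_cover: "finite C" if "C \<in> ?\<C>" for C
    using minimal_vertex_coversD(2)[OF that] finite_V by (rule finite_subset)
  \<comment> \<open>the exponents of a product of \<open>k\<close> of the \<open>u\<^sub>C\<close> are constant on chain steps and add up to \<open>k\<close> on matching edges,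
    so they can be recovered from \<open>\<beta> k m\<close>\<close>
  have inv: "Poly_Mapping.keys m \<subseteq> V \<and>
      (\<forall>i<r. \<forall>v\<in>c (Suc i) - c i. Poly_Mapping.lookup m v = Poly_Mapping.lookup m (rep i)) \<and>
      (\<forall>i\<in>{1..n}. Poly_Mapping.lookup m (x i) + Poly_Mapping.lookup m (y i) = k)"
    if "(k, m) \<in> cover_products ?\<C>" for k m
    using that
  proof (induction rule: cover_products.induct)
    case (Suc k m C)
    have "Poly_Mapping.keys (indicator_monomial C + m) \<subseteq> V"
      using Suc minimal_vertex_coversD(2)[OF Suc(2)] by (simp add: keys_plus_nat keys_indicator_monomial fin_cover)
    moreover have "Poly_Mapping.lookup (indicator_monomial C + m) v = Poly_Mapping.lookup (indicator_monomial C + m) (rep i)"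
      if "i < r" "v \<in> c (Suc i) - c i" for i v
      using same_step[OF Suc(2) that rep[OF that(1)]] Suc(3) that
      by (simp add: lookup_add lookup_indicator_monomial fin_cover[OF Suc(2)])
    moreover have "Poly_Mapping.lookup (indicator_monomial C + m) (x i) + Poly_Mapping.lookup (indicator_monomial C + m) (y i) = Suc k"
      if "i \<in> {1..n}" for i
    proof -
      have "Poly_Mapping.lookup m (x i) + Poly_Mapping.lookup m (y i) = k" using Suc(3) that by blast
      then show ?thesis
        using minimal_vertex_cover_iff[OF Suc(2) that]
        by (auto simp: lookup_add lookup_indicator_monomial fin_cover[OF Suc(2)])
    qed
    ultimately show ?case by blast
  qed simp
  have \<beta>_inj: "k = k' \<and> m = m'" if prods: "(k, m) \<in> cover_products ?\<C>" "(k', m') \<in> cover_products ?\<C>"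
    and eq: "\<beta> k m = \<beta> k' m'" for k m k' m'
  proof -
    have k: "k = k'" using arg_cong[OF eq, of "\<lambda>p. Poly_Mapping.lookup p 0"] by (simp add: \<beta>_lookup)
    have reps: "Poly_Mapping.lookup m (rep i) = Poly_Mapping.lookup m' (rep i)" if "i < r" for i
      using arg_cong[OF eq, of "\<lambda>p. Poly_Mapping.lookup p (Suc i)"] that by (simp add: \<beta>_lookup)
    have on_X: "Poly_Mapping.lookup m v = Poly_Mapping.lookup m' v" if "v \<in> X" for v
    proof -
      obtain i where "i < r" "v \<in> c (Suc i) - c i"
        using ex_least_nat_less[of "\<lambda>i. v \<in> c i" r] \<open>v \<in> X\<close> c_0 c_r by auto
      then show ?thesis using inv[OF prods(1)] inv[OF prods(2)] reps by metis
    qed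
    have on_Y: "Poly_Mapping.lookup m (y i) = Poly_Mapping.lookup m' (y i)" if "i \<in> {1..n}" for i
    proof -
      have "Poly_Mapping.lookup m (x i) + Poly_Mapping.lookup m (y i) = Poly_Mapping.lookup m' (x i) + Poly_Mapping.lookup m' (y i)"
        using inv[OF prods(1)] inv[OF prods(2)] that k by simp
      then show ?thesis using on_X[of "x i"] that by simp
    qed
    have "m = m'"
    proof (rule poly_mapping_eqI)
      fix v
      show "Poly_Mapping.lookup m v = Poly_Mapping.lookup m' v"
      proof (cases "v \<in> V")
        case True
        then show ?thesis using on_X on_Y V_eq by auto
      next
        case False
        then have "v \<notin> Poly_Mapping.keys m" "v \<notin> Poly_Mapping.keys m'"
          using inv[OF prods(1)] inv[OF prods(2)] by auto
        then show ?thesis by (simp add: in_keys_iff)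
      qed
    qed
    then show ?thesis using k by simp
  qed
  have \<beta>_0: "\<beta> 0 0 = 0" by (simp add: \<beta>_def)
  have \<beta>_add: "\<beta> (k + k') (m + m') = \<beta> k m + \<beta> k' m'" for k k' m m'
    by (simp add: \<beta>_def single_add lookup_add sum.distrib algebra_simps)
  have \<beta>_keys: "Poly_Mapping.keys (\<beta> k m) \<subseteq> {..<Suc r}" for k m
    by (auto simp: in_keys_iff \<beta>_lookup split: nat.splits if_splits)
  define B :: "(nat, 'k) mpoly set" where "B = lowest_part V n \<beta> ` carrier (vertex_cover_algebra V E)"
  note fibre = fibre_as_monomial_algebra[where ?'k = 'k and V = V and E = E and n = n and \<beta> = \<beta> and W = "{..<Suc r}", folded B_def]
  have dim: "krull_dim (vertex_cover_fibre V E :: ('v, 'k) mpoly poly set ring) =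
      krull_dim ((mpoly_ring {..<Suc r})\<lparr>carrier := B\<rparr>)"
    and subring: "subring B (mpoly_ring {..<Suc r})"
    and const: "Poly_Mapping.single 0 a \<in> B"
    and gen: "C \<in> ?\<C> \<Longrightarrow> Poly_Mapping.single (\<beta> 1 (indicator_monomial C)) 1 \<in> B" for a C
    by (rule fibre; (rule finite_V card_minimal_vertex_cover \<beta>_0 \<beta>_add \<beta>_keys \<beta>_inj | assumption)+)+
  \<comment> \<open>the cover that belongs to \<open>c s\<close> contains exactly the representatives of the first \<open>s\<close> steps\<close>
  have initial: "cover_monomial {..s} \<in> B" if "s < Suc r" for s
  proof -
    obtain C where C: "C \<in> ?\<C>" "C \<inter> X = c s" using c(1)[of s] \<open>s < Suc r\<close> unfolding cover_lattice_eq by fastforce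
    have rep_C: "rep i \<in> C \<longleftrightarrow> i < s" if "i < r" for i
    proof -
      have "rep i \<in> X" using rep[OF that] cover_lattice_subset[OF c(1), of "Suc i"] that by auto
      then have "rep i \<in> C \<longleftrightarrow> rep i \<in> c s" using C(2) by blast
      also have "\<dots> \<longleftrightarrow> i < s"
        using rep[OF that] mono[of "Suc i" s] mono[of s i] \<open>s < Suc r\<close> that by (cases "i < s") auto
      finally show ?thesis .
    qed
    have "\<beta> 1 (indicator_monomial C) = indicator_monomial {..s}"
      by (rule poly_mapping_eqI)
        (use that in \<open>auto simp: \<beta>_lookup lookup_indicator_monomial fin_cover[OF C(1)] rep_C split: nat.split\<close>)
    then show ?thesis using gen[OF C(1)] by (simp add: cover_monomial_eq)
  qed
  show ?thesis
    using krull_dim_subalgebra[OF subring const initial] dim by (simp add: r_def)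
qed

end

theorem theorem3:
  fixes V :: "'v set" and E :: "'v set set" and x y :: "nat \<Rightarrow> 'v" and n :: nat
  assumes "n \<ge> 1"
    and "simple_graph V E"
    and "no_isolated_vertices V E"
    and "inj_on x {1..n}" and "inj_on y {1..n}"
    and "bipartition V E (x ` {1..n}) (y ` {1..n})"
    and "\<forall>i\<in>{1..n}. {x i, y i} \<in> E"
    and "unmixed V E"
  shows "krull_dim (vertex_cover_fibre V E :: ('v, 'k::field) mpoly poly set ring) =
         enat (lattice_rank (cover_lattice V E (x ` {1..n})) + 1)"
proof -
  interpret unmixed_matched_bipartite V E x y n
    using assms by unfold_locales auto
  show ?thesis by (rule krull_dim_fibre)
qed

end
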